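(* Let $A, X_1, X_2, X_3, S, P$ be operators on a complex Hilbert space $\mathcal{H}$. Then: (1) $(A, X_1)$ is a $\mathbb{B}_2$-contraction if and only if $(A, X_1, 0, 0)$ is an $\mathbb{H}$-contraction; (2) $(X_1, X_2, X_3)$ is an $\mathbb{E}$-contraction if and only if $(0, X_1, X_2, X_3)$ is an $\mathbb{H}$-contraction; (3) $(A, S, P)$ is a $\mathbb{P}$-contraction if and only if $(A, S/2, S/2, P)$ is an $\mathbb{H}$-contraction; (4) $(S, P)$ is a $\Gamma$-contraction if and only if $(0, S/2, S/2, P)$ is an $\mathbb{H}$-contraction; (5) $(A, X_3)$ is a commuting pair of contractions if and only if $(A, 0, 0, X_3)$ is an $\mathbb{H}$-contraction.
   Context: All operators are bounded linear maps on complex Hilbert spaces; a contraction is an operator of norm at most $1$; $\mathbb{D}$ is the open unit disc in $\mathbb{C}$. $\mathbb{B}_2$ is the open Euclidean unit ball of $\mathbb{C}^2$. The tetrablock is $\mathbb{E}=\{(x_1,x_2,x_3)\in\mathbb{C}^3 : 1-x_1z_1-x_2z_2+x_3z_1z_2\neq 0 \text{ whenever } |z_1|\le 1, |z_2|\le 1\}$. The hexablock is $\mathbb{H}=\{(a,x_1,x_2,x_3)\in\mathbb{C}\times\mathbb{E} : \sup_{z_1,z_2\in\mathbb{D}}\left|\frac{a\sqrt{(1-|z_1|^2)(1-|z_2|^2)}}{1-x_1z_1-x_2z_2+x_3z_1z_2}\right|<1\}$. The symmetrized bidisc is $\mathbb{G}_2=\{(z_1+z_2,z_1z_2): |z_1|,|z_2|<1\}$,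 $\Gamma=\overline{\mathbb{G}_2}$, and the pentablock is $\mathbb{P}=\{(a,s,p)\in\mathbb{C}\times\mathbb{G}_2 : \sup_{z\in\mathbb{D}}\left|\frac{a(1-|z|^2)}{1-sz+pz^2}\right|<1\}$. The closures of these domains are polynomially convex. For a bounded domain $\Omega\subset\mathbb{C}^n$ with polynomially convex closure, a commuting $n$-tuple $\underline{T}$ of operators is an $\Omega$-contraction (also called $\overline{\Omega}$-contraction; so a $\Gamma$-contraction is a $\mathbb{G}_2$-contraction) if $\overline{\Omega}$ is a spectral set for $\underline{T}$, i.e. $\|p(\underline{T})\|\le\sup_{\overline{\Omega}}|p|$ for every $p\in\mathbb{C}[z_1,\dots,z_n]$. *)

theory Defs
  imports "HOL-Analysis.Analysis" "HOL-Library.Poly_Mapping"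
begin

section \<open>Complex Hilbert spaces\<close>

class scaleC = scaleR +
  fixes scaleC :: "complex \<Rightarrow> 'a \<Rightarrow> 'a"  (infixr "*\<^sub>C" 75)

text \<open>The underlying real normed space is complete by \<^class>\<open>banach\<close>; the remaining axioms add a
  compatible complex scalar multiplication and an inner product, linear in its first argument,
  that induces the norm.\<close>

class complex_hilbert = banach + scaleC +
  fixes cinner :: "'a \<Rightarrow> 'a \<Rightarrow> complex"
  assumes scaleC_add_right: "c *\<^sub>C (x + y) = c *\<^sub>C x + c *\<^sub>C y"
    and scaleC_add_left: "(c + d) *\<^sub>C x = c *\<^sub>C x + d *\<^sub>C x"
    and scaleC_scaleC: "c *\<^sub>C (d *\<^sub>C x) = (c * d) *\<^sub>C x"
    and scaleR_scaleC: "r *\<^sub>R x = complex_of_real r *\<^sub>C x"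
    and cinner_add_left: "cinner (x + y) z = cinner x z + cinner y z"
    and cinner_scaleC_left: "cinner (c *\<^sub>C x) y = c * cinner x y"
    and cinner_commute: "cinner y x = cnj (cinner x y)"
    and cinner_self: "cinner x x = complex_of_real ((norm x)\<^sup>2)"

lemma norm_scaleC: "norm (c *\<^sub>C x) = cmod c * norm x" for x :: "'a::complex_hilbert"
proof -
  have "cinner (c *\<^sub>C x) (c *\<^sub>C x) = c * cnj c * cinner x x"
    by (metis (no_types, lifting) cinner_commute cinner_scaleC_left complex_cnj_mult mult.assoc
        complex_cnj_cnj)
  then have "complex_of_real ((norm (c *\<^sub>C x))\<^sup>2) = complex_of_real ((cmod c * norm x)\<^sup>2)"
    by (simp add: cinner_self complex_norm_square power_mult_distrib flip: of_real_power)
  then show ?thesis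
    by (simp only: of_real_eq_iff) (simp add: power2_eq_iff_nonneg)
qed

lemma bounded_linear_scaleC: "bounded_linear (\<lambda>x :: 'a::complex_hilbert. c *\<^sub>C x)"
proof (rule bounded_linear_intro)
  show "c *\<^sub>C (r *\<^sub>R x) = r *\<^sub>R (c *\<^sub>C x)" for r and x :: 'a
    by (simp add: scaleR_scaleC scaleC_scaleC mult.commute)
  show "norm (c *\<^sub>C x) \<le> norm x * cmod c" for x :: 'a
    by (simp add: norm_scaleC mult.commute)
qed (rule scaleC_add_right)


section \<open>Operators\<close>

text \<open>The type \<open>'a \<Rightarrow>\<^sub>L 'a\<close> consists of the bounded \<^emph>\<open>real\<close>-linear maps. An operator is an
  element of this type that satisfies the predicate \<open>complex_linear\<close>.\<close>

definition complex_linear :: "('a::complex_hilbert \<Rightarrow>\<^sub>L 'a) \<Rightarrow> bool"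
  where "complex_linear T \<longleftrightarrow> (\<forall>c x. blinfun_apply T (c *\<^sub>C x) = c *\<^sub>C blinfun_apply T x)"

instantiation blinfun :: (real_normed_vector, complex_hilbert) scaleC
begin

lift_definition scaleC_blinfun :: "complex \<Rightarrow> ('a \<Rightarrow>\<^sub>L 'b) \<Rightarrow> 'a \<Rightarrow>\<^sub>L 'b"
  is "\<lambda>c f x. c *\<^sub>C f x"
  by (rule bounded_linear_compose[OF bounded_linear_scaleC])

instance ..

end

definition commuting_tuple :: "(('a::real_normed_vector \<Rightarrow>\<^sub>L 'a) ^ 'n) \<Rightarrow> bool"
  where "commuting_tuple T \<longleftrightarrow> (\<forall>i j. T $ i o\<^sub>L T $ j = T $ j o\<^sub>L T $ i)"


section \<open>Polynomials in several variables\<close>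

text \<open>Finitely supported maps from exponents to coefficients; the variables are indexed by \<open>'n\<close>.\<close>

type_synonym 'n cpoly = "('n \<Rightarrow>\<^sub>0 nat) \<Rightarrow>\<^sub>0 complex"

definition poly_at :: "'n::finite cpoly \<Rightarrow> complex ^ 'n::finite \<Rightarrow> complex"
  where "poly_at p z =
    (\<Sum>m\<in>Poly_Mapping.keys p. Poly_Mapping.lookup p m * (\<Prod>i\<in>UNIV. (z $ i) ^ Poly_Mapping.lookup m i))"

text \<open>The product of the powers of the \<open>T $ i\<close>, taken in increasing order of \<open>i\<close>. The order is
  irrelevant for the commuting tuples to which this is applied.\<close>

definition monom_op ::
    "('n::{finite,linorder} \<Rightarrow>\<^sub>0 nat) \<Rightarrow> ('a::complex_hilbert \<Rightarrow>\<^sub>L 'a) ^ 'n::{finite,linorder} \<Rightarrow> 'a \<Rightarrow>\<^sub>L 'a"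
  where "monom_op m T =
    foldr (\<lambda>i R. (((o\<^sub>L) (T $ i)) ^^ Poly_Mapping.lookup m i) R) (sorted_list_of_set UNIV) id_blinfun"

definition poly_op ::
    "'n::{finite,linorder} cpoly \<Rightarrow> ('a::complex_hilbert \<Rightarrow>\<^sub>L 'a) ^ 'n::{finite,linorder} \<Rightarrow> 'a \<Rightarrow>\<^sub>L 'a"
  where "poly_op p T = (\<Sum>m\<in>Poly_Mapping.keys p. Poly_Mapping.lookup p m *\<^sub>C monom_op m T)"


section \<open>Contractions associated with a domain\<close>

text \<open>Meant for bounded nonempty \<open>\<Omega>\<close> with polynomially convex closure: then the supremum is
  that of a nonempty bounded set of reals, and the inequality alone expresses that the closure
  is a spectral set (the joint spectrum is automatically contained in it).\<close>

definition domain_contraction ::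
    "(complex ^ 'n::{finite,linorder}) set \<Rightarrow> ('a::complex_hilbert \<Rightarrow>\<^sub>L 'a) ^ 'n::{finite,linorder} \<Rightarrow> bool"
  where "domain_contraction \<Omega> T \<longleftrightarrow>
    (\<forall>i. complex_linear (T $ i)) \<and> commuting_tuple T \<and>
    (\<forall>p. norm (poly_op p T) \<le> (SUP z\<in>closure \<Omega>. cmod (poly_at p z)))"


section \<open>The domains\<close>

text \<open>The norm of \<open>complex ^ 2\<close> is the Euclidean one.\<close>

definition ball2 :: "(complex ^ 2) set"
  where "ball2 = ball 0 1"

definition tetrablock :: "(complex ^ 3) set"
  where "tetrablock = {vector [x1, x2, x3] | x1 x2 x3.
    \<forall>z1 z2. cmod z1 \<le> 1 \<and> cmod z2 \<le> 1 \<longrightarrow> 1 - x1 * z1 - x2 * z2 + x3 * z1 * z2 \<noteq> 0}"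

text \<open>In the next definition, and likewise for the pentablock, the denominator is continuous and
  zero-free on the closed bidisc (disc), so the supremum is that of a bounded set of reals.\<close>

definition hexablock :: "(complex ^ 4) set"
  where "hexablock = {vector [a, x1, x2, x3] | a x1 x2 x3.
    vector [x1, x2, x3] \<in> tetrablock \<and>
    (SUP (z1, z2)\<in>ball 0 1 \<times> ball 0 1.
      cmod (a * complex_of_real (sqrt ((1 - (cmod z1)\<^sup>2) * (1 - (cmod z2)\<^sup>2)))
        / (1 - x1 * z1 - x2 * z2 + x3 * z1 * z2))) < 1}"

definition symmetrized_bidisc :: "(complex ^ 2) set"
  where "symmetrized_bidisc = {vector [z1 + z2, z1 * z2] | z1 z2. cmod z1 < 1 \<and> cmod z2 < 1}"

definition pentablock :: "(complex ^ 3) set"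
  where "pentablock = {vector [a, s, p] | a s p.
    vector [s, p] \<in> symmetrized_bidisc \<and>
    (SUP z\<in>ball 0 1. cmod (a * complex_of_real (1 - (cmod z)\<^sup>2) / (1 - s * z + p * z\<^sup>2))) < 1}"

end

theory Submission
  imports Defs "HOL-Complex_Analysis.Conformal_Mappings"
begin

text \<open>Each item compares two operator tuples that are images of each other under linear maps, and these
maps carry the domain of each tuple into that of the other; in the last item the bidisc is the domain
of \<open>(A, X\<^sub>3)\<close>. If a linear map \<open>L\<close> sends \<open>\<Omega>\<close> into \<open>\<Omega>'\<close>, then
\<open>\<parallel>p(L T)\<parallel> = \<parallel>(p \<circ> L)(T)\<parallel>\<close> is at most the supremum of \<open>\<bar>p \<circ> L\<bar>\<close> over the closure of \<open>\<Omega>\<close>, hence at most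
that of \<open>\<bar>p\<bar>\<close> over the closure of \<open>\<Omega>'\<close>; so \<open>L T\<close> is an \<open>\<Omega>'\<close>-contraction as soon as \<open>T\<close> is an
\<open>\<Omega>\<close>-contraction (\<open>domain_contraction_linear_image\<close>). This leaves inclusions between domains, and
Ando's inequality, which says that a commuting pair of contractions is a contraction for the bidisc.

The one inclusion that needs an idea is that \<open>(a, s, p)\<close> in the pentablock gives
\<open>(a, s/2, s/2, p)\<close> in the hexablock. The supremum defining the pentablock is the hexablock supremum
restricted to the diagonal, so the value of the polarised polynomial
\<open>1 - s (z\<^sub>1 + z\<^sub>2)/2 + p z\<^sub>1 z\<^sub>2\<close> must be controlled by a value of \<open>1 - s z + p z\<^sup>2\<close>. The value at the
hyperbolic midpoint of \<open>z\<^sub>1\<close> and \<open>z\<^sub>2\<close> does it (\<open>polarization_bound\<close>): after the disc automorphism that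
sends the midpoint to \<open>0\<close> the two points are \<open>w\<close> and \<open>-w\<close>, and the linear coefficient drops out.

Ando's inequality is proved without dilations. Let \<open>T\<^sub>1, T\<^sub>2\<close> commute and have norms below \<open>1\<close>, and let
\<open>D\<^sub>j = 1 - T\<^sub>j\<^sup>* T\<^sub>j\<close>. Represent \<open>h\<close> by the function \<open>(1 - z\<^sup>* T\<^sub>1)\<^sup>-\<^sup>1 h\<close> on the unit circle, where \<open>z\<^sup>*\<close> is the
conjugate of \<open>z\<close>; its Fourier coefficient of index \<open>-n\<close> is \<open>T\<^sub>1\<^sup>n h\<close>, and \<open>\<parallel>h\<parallel>\<^sup>2\<close> is the mean of its squared length in
the inner product \<open>\<langle>D\<^sub>1 u, v\<rangle>\<close>. Up to analytic functions vanishing at \<open>0\<close>, the operator \<open>T\<^sub>1\<close> acts on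
these functions as multiplication by \<open>z\<close>, and \<open>T\<^sub>2\<close> as multiplication by the operator function
\<open>\<Phi>(z) = T\<^sub>2 (1 - (T\<^sub>1 T\<^sub>2)\<^sup>* (T\<^sub>1 T\<^sub>2) - z T\<^sub>1\<^sup>* D\<^sub>2)\<^sup>-\<^sup>1 D\<^sub>1\<close>, whose values are contractions for \<open>\<langle>D\<^sub>1 u, v\<rangle>\<close>.
Von Neumann's inequality bounds \<open>p(z, \<Phi>(z))\<close> at each point of the circle, and the minimum principle
for harmonic functions carries the bound to \<open>p(T\<^sub>1, T\<^sub>2)\<close> (\<open>boundary_estimate\<close>). Von Neumann's
inequality itself follows from the same estimate.\<close>

section \<open>Complex Hilbert spaces\<close>

lemma scaleC_one [simp]: "1 *\<^sub>C x = x" for x :: "'a::complex_hilbert"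
  using scaleR_scaleC[of 1 x] by simp

lemma scaleC_zero [simp]: "0 *\<^sub>C x = 0" for x :: "'a::complex_hilbert"
  using scaleR_scaleC[of 0 x] by simp

lemma scaleC_zero_right [simp]: "c *\<^sub>C (0 :: 'a::complex_hilbert) = 0"
  using bounded_linear.linear[OF bounded_linear_scaleC] linear_0 by blast

lemma scaleC_minus_right: "c *\<^sub>C (- x) = - (c *\<^sub>C x)" for x :: "'a::complex_hilbert"
  using bounded_linear.linear[OF bounded_linear_scaleC] linear_neg by blast

lemma scaleC_minus_left: "(- c) *\<^sub>C x = - (c *\<^sub>C x)" for x :: "'a::complex_hilbert"
  using scaleC_add_left[of c "- c" x] by (simp add: add_eq_0_iff)

lemma scaleC_diff_right: "c *\<^sub>C (x - y) = c *\<^sub>C x - c *\<^sub>C y" for x :: "'a::complex_hilbert"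
  using scaleC_add_right[of c x "- y"] by (simp add: scaleC_minus_right)

lemma scaleC_diff_left: "(c - d) *\<^sub>C x = c *\<^sub>C x - d *\<^sub>C x" for x :: "'a::complex_hilbert"
  using scaleC_add_left[of c "- d" x] by (simp add: scaleC_minus_left)

lemma scaleC_sum_right: "c *\<^sub>C sum f A = (\<Sum>i\<in>A. c *\<^sub>C f i)" for f :: "'b \<Rightarrow> 'a::complex_hilbert"
  using bounded_linear.linear[OF bounded_linear_scaleC] linear_sum by blast

lemma scaleC_sum_left: "sum f A *\<^sub>C x = (\<Sum>i\<in>A. f i *\<^sub>C x)" for x :: "'a::complex_hilbert"
  by (induction A rule: infinite_finite_induct) (simp_all add: scaleC_add_left)

lemma scaleC_minus_one: "(- 1) *\<^sub>C x = - x" for x :: "'a::complex_hilbert"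
  by (simp add: scaleC_minus_left)

lemmas scaleC_distribs = scaleC_add_right scaleC_add_left scaleC_diff_right scaleC_diff_left
  scaleC_minus_right scaleC_minus_left scaleC_scaleC

lemma cinner_scaleC_right: "cinner x (c *\<^sub>C y) = cnj c * cinner x y" for x :: "'a::complex_hilbert"
  by (metis cinner_commute cinner_scaleC_left complex_cnj_mult)

lemma cinner_add_right: "cinner x (y + z) = cinner x y + cinner x z" for x :: "'a::complex_hilbert"
  by (metis cinner_commute cinner_add_left complex_cnj_add)

lemma Re_cinner_self: "Re (cinner x x) = (norm x)\<^sup>2" for x :: "'a::complex_hilbert"
  by (simp add: cinner_self)

lemma cinner_minus_left: "cinner (- x) y = - cinner x y" for x :: "'a::complex_hilbert"
  by (metis cinner_scaleC_left mult_minus1 scaleC_minus_one)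

lemma cinner_minus_right: "cinner x (- y) = - cinner x y" for x :: "'a::complex_hilbert"
  by (metis cinner_commute cinner_minus_left complex_cnj_minus)

lemma cinner_diff_left: "cinner (x - y) z = cinner x z - cinner y z" for x :: "'a::complex_hilbert"
  using cinner_add_left[of x "- y" z] by (simp add: cinner_minus_left)

lemma cinner_diff_right: "cinner x (y - z) = cinner x y - cinner x z" for x :: "'a::complex_hilbert"
  using cinner_add_right[of x y "- z"] by (simp add: cinner_minus_right)

lemmas cinner_distribs = cinner_add_left cinner_add_right cinner_diff_left cinner_diff_right
  cinner_scaleC_left cinner_scaleC_right

lemma Re_cinner_le: "Re (cinner x y) \<le> norm x * norm y" for x :: "'a::complex_hilbert"
proof (cases "x = 0 \<or> y = 0")
  case True
  then show ?thesis
    by (metis cinner_scaleC_left cinner_scaleC_right complex_cnj_zero mult_zero_left norm_zero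
        order_refl scaleC_zero zero_complex.simps(1) mult_zero_right)
next
  case False
  define a b where "a = norm x" and "b = norm y"
  have pos: "a > 0" "b > 0" using False by (auto simp: a_def b_def)
  have "0 \<le> Re (cinner (complex_of_real b *\<^sub>C x - complex_of_real a *\<^sub>C y)
      (complex_of_real b *\<^sub>C x - complex_of_real a *\<^sub>C y))"
    by (simp add: Re_cinner_self)
  also have "\<dots> = b\<^sup>2 * a\<^sup>2 + a\<^sup>2 * b\<^sup>2 - 2 * a * b * Re (cinner x y)"
    using cinner_commute[of y x] unfolding cinner_distribs
    by (simp add: cinner_self a_def b_def algebra_simps power2_eq_square)
  finally have "(a * b) * Re (cinner x y) \<le> (a * b) * (a * b)"
    by (simp add: power2_eq_square algebra_simps)
  then show ?thesis using pos by (simp add: a_def b_def)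
qed

lemma norm_cinner_le: "norm (cinner x y) \<le> norm x * norm y" for x :: "'a::complex_hilbert"
proof (cases "cinner x y = 0")
  case False
  define c where "c = cnj (cinner x y) / norm (cinner x y)"
  have "Re (cinner (c *\<^sub>C x) y) = norm (cinner x y)"
    using False by (simp add: cinner_scaleC_left c_def complex_norm_square[symmetric]
        mult.commute power2_eq_square)
  moreover have "norm c = 1" using False by (simp add: c_def norm_divide)
  ultimately show ?thesis using Re_cinner_le[of "c *\<^sub>C x" y] by (simp add: norm_scaleC)
qed simp

lemma bounded_bilinear_cinner: "bounded_bilinear (cinner :: 'a::complex_hilbert \<Rightarrow> 'a \<Rightarrow> complex)"
proof
  show "cinner (r *\<^sub>R a) b = r *\<^sub>R cinner a b" for r and a b :: 'a
    by (simp add: scaleR_scaleC cinner_scaleC_left scaleR_conv_of_real)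
  show "cinner a (r *\<^sub>R b) = r *\<^sub>R cinner a b" for r and a b :: 'a
    by (simp add: scaleR_scaleC cinner_scaleC_right scaleR_conv_of_real)
  show "\<exists>K. \<forall>a b :: 'a. norm (cinner a b) \<le> norm a * norm b * K"
    by (rule exI[of _ 1]) (simp add: norm_cinner_le)
qed (rule cinner_add_left cinner_add_right)+

lemma cinner_ext: "(\<And>z. cinner x z = cinner y z) \<Longrightarrow> x = y" for x :: "'a::complex_hilbert"
proof -
  assume "\<And>z. cinner x z = cinner y z"
  then have "cinner (x - y) (x - y) = 0" by (simp add: cinner_diff_left)
  then show ?thesis by (simp add: cinner_self)
qed

lemma parallelogram:
  "(norm (x + y))\<^sup>2 + (norm (x - y))\<^sup>2 = 2 * (norm x)\<^sup>2 + 2 * (norm y)\<^sup>2" for x :: "'a::complex_hilbert"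
  by (simp add: Re_cinner_self[symmetric] cinner_distribs)

text \<open>The first-order condition at a minimum, for a quadratic polynomial in a real parameter.\<close>

lemma quadratic_nonneg_imp_linear_zero:
  fixes a b :: real
  assumes "\<And>t. 0 \<le> t * a + t\<^sup>2 * b"
  shows "a = 0"
proof (rule ccontr)
  assume a: "a \<noteq> 0"
  define d where "d = \<bar>b\<bar> + 1"
  have d: "d > 0" by (simp add: d_def)
  define t where "t = - a / (2 * d)"
  have "t * a + t\<^sup>2 * b \<le> t * a + t\<^sup>2 * d"
    by (intro add_left_mono mult_left_mono) (auto simp: d_def)
  also have "\<dots> = - a\<^sup>2 / (4 * d)"
    using d by (simp add: t_def field_simps power2_eq_square)
  also have "\<dots> < 0" using a d by (simp add: field_simps)
  finally show False using assms[of t] by simp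
qed

text \<open>The Riesz representation theorem: the representing vector minimises the functional
  \<open>\<parallel>x\<parallel>\<^sup>2 - 2 Re f(x)\<close>; by the parallelogram law every minimising sequence is Cauchy.\<close>

lemma riesz_representation:
  fixes f :: "'a::complex_hilbert \<Rightarrow> complex"
  assumes f: "bounded_linear f" and fC: "\<And>c x. f (c *\<^sub>C x) = c * f x"
  shows "\<exists>w. \<forall>x. f x = cinner x w"
proof -
  interpret f: bounded_linear f by fact
  obtain B where B: "\<And>x. norm (f x) \<le> norm x * B"
    using f.bounded by blast
  define J where "J x = (norm x)\<^sup>2 - 2 * Re (f x)" for x
  define m where "m = Inf (range J)"
  have Jge: "J x \<ge> - B\<^sup>2" for x
  proof -
    have "Re (f x) \<le> norm x * B" using B[of x] complex_Re_le_cmod[of "f x"] by linarith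
    moreover have "0 \<le> (norm x - B)\<^sup>2" by simp
    ultimately show ?thesis by (simp add: J_def power2_diff)
  qed
  have bdd: "bdd_below (range J)" using Jge by (auto simp: bdd_below_def)
  have m_le: "m \<le> J x" for x unfolding m_def by (rule cInf_lower[OF _ bdd]) simp
  have "\<exists>x. J x < m + 1 / Suc n" for n
  proof -
    have "Inf (range J) < m + 1 / Suc n" by (simp add: m_def)
    then show ?thesis using cInf_lessD[of "range J"] by auto
  qed
  then obtain X where X: "\<And>n. J (X n) < m + 1 / Suc n" by metis
  have par: "(norm (x - y))\<^sup>2 \<le> 2 * J x + 2 * J y - 4 * m" for x y
  proof -
    have "(norm ((1/2) *\<^sub>R (x + y)))\<^sup>2 = (norm (x + y))\<^sup>2 / 4"
      by (simp add: power_divide)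
    then have "J ((1/2) *\<^sub>R (x + y)) = (norm (x + y))\<^sup>2 / 4 - Re (f x) - Re (f y)"
      by (simp add: J_def f.scaleR f.add power_divide del: scaleR_add_right)
        (simp add: field_simps)?
    then have "4 * m \<le> (norm (x + y))\<^sup>2 - 4 * Re (f x) - 4 * Re (f y)"
      using m_le[of "(1/2) *\<^sub>R (x + y)"] by simp
    then show ?thesis using parallelogram[of x y] by (simp add: J_def)
  qed
  have "Cauchy X"
  proof (rule metric_CauchyI)
    fix e :: real assume e: "e > 0"
    obtain N :: nat where N: "4 / e\<^sup>2 < N" using reals_Archimedean2 by blast
    have "dist (X i) (X j) < e" if "i \<ge> N" "j \<ge> N" for i j
    proof -
      have "4 < e\<^sup>2 * N" using N e by (simp add: field_simps)
      also have "\<dots> \<le> e\<^sup>2 * Suc N" by (simp add: mult_left_mono)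
      finally have "4 / Suc N < e\<^sup>2" by (simp add: field_simps)
      moreover have "1 / Suc i \<le> 1 / Suc N" "1 / Suc j \<le> 1 / Suc N"
        using that by (auto simp: frac_le)
      ultimately have "(norm (X i - X j))\<^sup>2 < e\<^sup>2"
        using par[of "X i" "X j"] X[of i] X[of j] by simp
      then show ?thesis using e by (simp add: dist_norm power_less_imp_less_base)
    qed
    then show "\<exists>M. \<forall>i\<ge>M. \<forall>j\<ge>M. dist (X i) (X j) < e" by blast
  qed
  then obtain w where w: "X \<longlonglongrightarrow> w" by (metis Cauchy_convergent_iff convergent_def)
  have "(\<lambda>n. J (X n)) \<longlonglongrightarrow> J w"
    unfolding J_def by (intro tendsto_intros f.tendsto w)
  moreover have "(\<lambda>n. m + 1 / Suc n) \<longlonglongrightarrow> m + 0"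
    by (intro tendsto_intros LIMSEQ_Suc lim_1_over_n)
  ultimately have "J w \<le> m + 0"
    using X by (intro LIMSEQ_le[of "\<lambda>n. J (X n)" _ "\<lambda>n. m + 1 / Suc n"]) (auto intro: less_imp_le)
  then have Jw: "J w \<le> J x" for x using m_le[of x] by simp
  have re: "Re (f x) = Re (cinner x w)" for x
  proof -
    have "0 \<le> t * (2 * Re (cinner x w) - 2 * Re (f x)) + t\<^sup>2 * (norm x)\<^sup>2" for t
    proof -
      have "J (w + t *\<^sub>R x) = J w + t * (2 * Re (cinner x w) - 2 * Re (f x)) + t\<^sup>2 * (norm x)\<^sup>2"
        using cinner_commute[of w x]
        unfolding J_def f.scaleR f.add Re_cinner_self[symmetric] unfolding scaleR_scaleC cinner_distribs
        by (simp add: algebra_simps power2_eq_square)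
      then show ?thesis using Jw[of "w + t *\<^sub>R x"] by simp
    qed
    then have "2 * Re (cinner x w) - 2 * Re (f x) = 0"
      by (rule quadratic_nonneg_imp_linear_zero)
    then show ?thesis by simp
  qed
  have "f x = cinner x w" for x
  proof (rule complex_eqI)
    show "Im (f x) = Im (cinner x w)"
      using re[of "\<i> *\<^sub>C x"] by (simp add: fC cinner_scaleC_left)
  qed (rule re)
  then show ?thesis by blast
qed


section \<open>Complex-linear operators\<close>

text \<open>Operators are treated as plain functions here, so that powers and compositions are those of
  functions.\<close>

definition clin :: "('a::complex_hilbert \<Rightarrow> 'a) \<Rightarrow> bool"
  where "clin f \<longleftrightarrow> bounded_linear f \<and> (\<forall>c x. f (c *\<^sub>C x) = c *\<^sub>C f x)"

lemma clin_blinfun: "complex_linear T \<Longrightarrow> clin (blinfun_apply T)"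
  by (simp add: clin_def complex_linear_def blinfun.bounded_linear_right)

lemma clinI:
  assumes "\<And>x y. f (x + y) = f x + f y" "\<And>c x. f (c *\<^sub>C x) = c *\<^sub>C f x"
    "\<And>x. norm (f x) \<le> norm x * B"
  shows "clin f"
  using assms by (auto simp: clin_def scaleR_scaleC intro!: bounded_linear_intro[where K = B])

lemma clin_add: "clin f \<Longrightarrow> f (x + y) = f x + f y"
  by (simp add: clin_def bounded_linear.linear linear_add)

lemma clin_diff: "clin f \<Longrightarrow> f (x - y) = f x - f y"
  by (simp add: clin_def bounded_linear.linear linear_diff)

lemma clin_zero: "clin f \<Longrightarrow> f 0 = 0"
  by (simp add: clin_def bounded_linear.linear linear_0)

lemma clin_scaleC: "clin f \<Longrightarrow> f (c *\<^sub>C x) = c *\<^sub>C f x"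
  by (simp add: clin_def)

lemma clin_sum: "clin f \<Longrightarrow> f (sum g A) = (\<Sum>i\<in>A. f (g i))"
  by (simp add: clin_def bounded_linear.linear linear_sum)

lemma clin_tendsto: "clin f \<Longrightarrow> (g \<longlongrightarrow> l) F \<Longrightarrow> ((\<lambda>x. f (g x)) \<longlongrightarrow> f l) F"
  unfolding clin_def using bounded_linear.tendsto by blast

lemma clin_bound:
  assumes "clin f"
  obtains B where "B > 0" "\<And>x. norm (f x) \<le> B * norm x"
  using assms bounded_linear.pos_bounded[of f] unfolding clin_def by (metis mult.commute)

lemma clin_id: "clin (\<lambda>x. x)"
  by (simp add: clin_def)

lemma clin_compose: "clin f \<Longrightarrow> clin g \<Longrightarrow> clin (\<lambda>x. f (g x))"
  by (simp add: clin_def bounded_linear_compose)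

lemma clin_sub: "clin f \<Longrightarrow> clin g \<Longrightarrow> clin (\<lambda>x. f x - g x)"
  by (simp add: clin_def bounded_linear_sub scaleC_diff_right)

lemma clin_scale: "clin f \<Longrightarrow> clin (\<lambda>x. c *\<^sub>C f x)"
  unfolding clin_def
  by (auto intro: bounded_linear_compose[OF bounded_linear_scaleC] simp: scaleC_scaleC mult.commute)

lemma clin_power: "clin f \<Longrightarrow> clin (f ^^ n)"
proof (induction n)
  case 0 then show ?case by (simp add: clin_id id_def)
next
  case (Suc n) then show ?case by (simp add: comp_def clin_compose)
qed

text \<open>Riesz applied to \<open>x \<mapsto> \<langle>f x, y\<rangle>\<close> for each \<open>y\<close>; uniqueness of the representing vector makes the
  result linear.\<close>

lemma adjoint_exists:
  assumes f: "clin f"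
  shows "\<exists>g. clin g \<and> (\<forall>x y. cinner (f x) y = cinner x (g y))"
proof -
  have "\<exists>w. \<forall>x. cinner (f x) y = cinner x w" for y
  proof (rule riesz_representation)
    show "bounded_linear (\<lambda>x. cinner (f x) y)"
      using f bounded_linear_compose[OF bounded_bilinear.bounded_linear_left[OF bounded_bilinear_cinner]]
      by (auto simp: clin_def)
  qed (simp add: clin_scaleC[OF f] cinner_scaleC_left)
  then obtain g where g: "\<And>x y. cinner (f x) y = cinner x (g y)" by metis
  have g': "cinner (g y) x = cinner y (f x)" for x y
    by (metis g cinner_commute)
  obtain B where B: "B > 0" "\<And>x. norm (f x) \<le> B * norm x" using clin_bound[OF f] by metis
  have "clin g"
  proof (rule clinI)
    show "g (x + y) = g x + g y" for x y
      by (rule cinner_ext) (simp add: g' cinner_add_left)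
    show "g (c *\<^sub>C x) = c *\<^sub>C g x" for c x
      by (rule cinner_ext) (simp add: g' cinner_scaleC_left)
    show "norm (g x) \<le> norm x * B" for x
    proof (cases "g x = 0")
      case False
      have "(norm (g x))\<^sup>2 = Re (cinner x (f (g x)))"
        by (simp add: g'[symmetric] Re_cinner_self)
      also have "\<dots> \<le> norm x * (B * norm (g x))"
        by (rule order_trans[OF Re_cinner_le]) (simp add: B mult_left_mono)
      finally have "norm (g x) * norm (g x) \<le> (norm x * B) * norm (g x)"
        by (simp add: power2_eq_square algebra_simps)
      then show ?thesis using False by simp
    qed (use B in simp)
  qed
  then show ?thesis using g by blast
qed

text \<open>The Lax-Milgram theorem for an operator with coercive real part. For a small step \<open>t\<close> the map
  \<open>h \<mapsto> h - t (B h - f)\<close> is a strict contraction of the complete space, and its fixed point solves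
  \<open>B h = f\<close>.\<close>

lemma coercive_bij:
  assumes B: "clin B" and c: "c > 0" and coer: "\<And>h. c * (norm h)\<^sup>2 \<le> Re (cinner (B h) h)"
  shows "bij B" and "clin (inv B)" and "norm (inv B f) \<le> norm f / c"
proof -
  have lower: "c * norm h \<le> norm (B h)" for h
  proof (cases "h = 0")
    case False
    have "c * norm h * norm h \<le> norm (B h) * norm h"
      using coer[of h] Re_cinner_le[of "B h" h] by (simp add: power2_eq_square)
    then show ?thesis using False by simp
  qed (simp add: c)
  obtain K where K: "K > 0" "\<And>x. norm (B x) \<le> K * norm x" using clin_bound[OF B] by metis
  define L where "L = max K c"
  have L: "L > 0" "c \<le> L" "\<And>x. norm (B x) \<le> L * norm x"
    using K c unfolding L_def by (auto intro!: order_trans[OF K(2)] mult_right_mono)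
  \<comment> \<open>the step that minimises the contraction factor \<open>1 - 2 t c + t\<^sup>2 L\<^sup>2\<close>\<close>
  define t where "t = c / L\<^sup>2"
  define q where "q = sqrt (1 - c\<^sup>2 / L\<^sup>2)"
  have t: "t > 0" using c L by (simp add: t_def)
  have cL: "c\<^sup>2 / L\<^sup>2 \<le> 1" using L c by (simp add: divide_le_eq power_mono)
  have q: "0 \<le> q" "q < 1" using c L cL unfolding q_def
    by (auto simp: real_sqrt_lt_1_iff)
  have contr: "norm (h - complex_of_real t *\<^sub>C B h) \<le> q * norm h" for h
  proof -
    have "(norm (h - complex_of_real t *\<^sub>C B h))\<^sup>2
        = (norm h)\<^sup>2 - 2 * t * Re (cinner (B h) h) + t\<^sup>2 * (norm (B h))\<^sup>2"
      using cinner_commute[of h "B h"] unfolding Re_cinner_self[symmetric] cinner_distribs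
      by (simp add: algebra_simps power2_eq_square)
    also have "\<dots> \<le> (norm h)\<^sup>2 - 2 * t * (c * (norm h)\<^sup>2) + t\<^sup>2 * (L * norm h)\<^sup>2"
      using t coer[of h] L(3)[of h]
      by (intro add_mono diff_mono mult_left_mono power_mono) auto
    also have "\<dots> = (1 - c\<^sup>2 / L\<^sup>2) * (norm h)\<^sup>2"
      using L by (simp add: t_def field_simps power2_eq_square)
    also have "\<dots> = (q * norm h)\<^sup>2"
      using cL by (simp add: q_def power_mult_distrib)
    finally show ?thesis using q by (simp add: power2_le_iff_abs_le)
  qed
  have "\<exists>h. B h = f" for f
  proof -
    define g where "g h = h - complex_of_real t *\<^sub>C (B h - f)" for h
    have lip: "dist (g x) (g y) \<le> q * dist x y" for x y
    proof -
      have "g x - g y = (x - y) - complex_of_real t *\<^sub>C B (x - y)"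
        by (simp add: g_def clin_diff[OF B] scaleC_diff_right)
      then show ?thesis using contr[of "x - y"] by (simp add: dist_norm)
    qed
    obtain x where "g x = x" using banach_fix_type[OF q] lip by blast
    then have "complex_of_real t *\<^sub>C (B x - f) = 0" by (simp add: g_def)
    then have "norm (complex_of_real t *\<^sub>C (B x - f)) = 0" by simp
    then show ?thesis using t by (auto simp: norm_scaleC)
  qed
  then have "surj B" by (metis surjI)
  moreover have "inj B"
  proof (rule injI)
    fix x y assume "B x = B y"
    then have "c * norm (x - y) \<le> 0" using lower[of "x - y"] by (simp add: clin_diff[OF B])
    then show "x = y" using c by (simp add: mult_le_0_iff)
  qed
  ultimately show bij: "bij B" by (simp add: bij_def)
  have BR: "B (inv B f) = f" for f using bij by (simp add: bij_is_surj surj_f_inv_f)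
  have RB: "inv B (B f) = f" for f using bij by (simp add: bij_is_inj)
  have bd: "norm (inv B f) \<le> norm f / c" for f
    using lower[of "inv B f"] c by (simp add: BR field_simps)
  show "clin (inv B)"
  proof (rule clinI)
    show "inv B (x + y) = inv B x + inv B y" for x y
      by (metis BR RB clin_add[OF B])
    show "inv B (a *\<^sub>C x) = a *\<^sub>C inv B x" for a x
      by (metis BR RB clin_scaleC[OF B])
    show "norm (inv B x) \<le> norm x * (1 / c)" for x using bd[of x] by simp
  qed
  show "norm (inv B f) \<le> norm f / c" by (rule bd)
qed


section \<open>Vector-valued holomorphic functions on the closed disc\<close>

lemma bounded_bilinear_scaleC: "bounded_bilinear (\<lambda>c (x :: 'a::complex_hilbert). c *\<^sub>C x)"
proof
  show "(r *\<^sub>R a) *\<^sub>C b = r *\<^sub>R (a *\<^sub>C b)" "a *\<^sub>C (r *\<^sub>R b) = r *\<^sub>R (a *\<^sub>C b)" for r a and b :: 'a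
    by (simp_all add: scaleR_scaleC scaleC_scaleC scaleR_conv_of_real mult.commute)
  show "\<exists>K. \<forall>a (b :: 'a). norm (a *\<^sub>C b) \<le> norm a * norm b * K"
    by (rule exI[of _ 1]) (simp add: norm_scaleC)
qed (rule scaleC_add_left scaleC_add_right)+

lemmas tendsto_scaleC = bounded_bilinear.tendsto[OF bounded_bilinear_scaleC]
lemmas tendsto_cinner = bounded_bilinear.tendsto[OF bounded_bilinear_cinner]

text \<open>Complex differentiability on the closed unit disc in Caratheodory's form, which has no quotients.
  At boundary points the derivative is taken within the disc, so continuity up to the boundary is
  included.\<close>

definition disc_holomorphic :: "(complex \<Rightarrow> 'a::complex_hilbert) \<Rightarrow> bool"
  where "disc_holomorphic F \<longleftrightarrow> (\<forall>w. norm w \<le> 1 \<longrightarrow> (\<exists>D d. (D \<longlongrightarrow> d) (at w within cball 0 1) \<and>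
    (\<forall>z. norm z \<le> 1 \<longrightarrow> F z - F w = (z - w) *\<^sub>C D z)))"

lemma disc_holomorphicI:
  assumes "\<And>w. norm w \<le> 1 \<Longrightarrow> \<exists>D d. (D \<longlongrightarrow> d) (at w within cball 0 1) \<and>
    (\<forall>z. norm z \<le> 1 \<longrightarrow> F z - F w = (z - w) *\<^sub>C D z)"
  shows "disc_holomorphic F"
  using assms unfolding disc_holomorphic_def by blast

lemma disc_holomorphicE:
  assumes "disc_holomorphic F" "norm w \<le> 1"
  obtains D d where "(D \<longlongrightarrow> d) (at w within cball 0 1)"
    "\<And>z. norm z \<le> 1 \<Longrightarrow> F z - F w = (z - w) *\<^sub>C D z"
  using assms unfolding disc_holomorphic_def by blast

lemma disc_holomorphic_tendsto:
  assumes "disc_holomorphic F" "norm w \<le> 1"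
  shows "(F \<longlongrightarrow> F w) (at w within cball 0 1)"
proof -
  obtain D d where D: "(D \<longlongrightarrow> d) (at w within cball 0 1)"
    "\<And>z. norm z \<le> 1 \<Longrightarrow> F z - F w = (z - w) *\<^sub>C D z"
    using disc_holomorphicE[OF assms] by metis
  have "((\<lambda>z. F w + (z - w) *\<^sub>C D z) \<longlongrightarrow> F w + (w - w) *\<^sub>C d) (at w within cball 0 1)"
    by (intro tendsto_intros tendsto_scaleC D(1))
  moreover have "eventually (\<lambda>z. F w + (z - w) *\<^sub>C D z = F z) (at w within cball 0 1)"
    unfolding eventually_at_filter by (intro always_eventually) (simp add: D(2)[symmetric])
  ultimately show ?thesis by (simp add: tendsto_cong)
qed

lemma disc_holomorphic_const: "disc_holomorphic (\<lambda>z. a)"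
  by (rule disc_holomorphicI) (auto intro!: exI[of _ "\<lambda>z. 0"])

lemma disc_holomorphic_add: "disc_holomorphic F \<Longrightarrow> disc_holomorphic H \<Longrightarrow> disc_holomorphic (\<lambda>z. F z + H z)"
proof (rule disc_holomorphicI)
  fix w :: complex assume a: "disc_holomorphic F" "disc_holomorphic H" "norm w \<le> 1"
  obtain D d D' d' where "(D \<longlongrightarrow> d) (at w within cball 0 1)" "(D' \<longlongrightarrow> d') (at w within cball 0 1)"
    "\<And>z. norm z \<le> 1 \<Longrightarrow> F z - F w = (z - w) *\<^sub>C D z"
    "\<And>z. norm z \<le> 1 \<Longrightarrow> H z - H w = (z - w) *\<^sub>C D' z"
    using disc_holomorphicE[OF a(1,3)] disc_holomorphicE[OF a(2,3)] by metis
  then show "\<exists>D d. (D \<longlongrightarrow> d) (at w within cball 0 1) \<and>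
    (\<forall>z. norm z \<le> 1 \<longrightarrow> F z + H z - (F w + H w) = (z - w) *\<^sub>C D z)"
    by (intro exI[of _ "\<lambda>z. D z + D' z"] exI[of _ "d + d'"])
      (auto intro: tendsto_add simp: scaleC_add_right add_diff_add)
qed

lemma disc_holomorphic_clin: "clin f \<Longrightarrow> disc_holomorphic F \<Longrightarrow> disc_holomorphic (\<lambda>z. f (F z))"
proof (rule disc_holomorphicI)
  fix w :: complex assume a: "clin f" "disc_holomorphic F" "norm w \<le> 1"
  obtain D d where "(D \<longlongrightarrow> d) (at w within cball 0 1)"
    "\<And>z. norm z \<le> 1 \<Longrightarrow> F z - F w = (z - w) *\<^sub>C D z"
    using disc_holomorphicE[OF a(2,3)] by metis
  then show "\<exists>D d. (D \<longlongrightarrow> d) (at w within cball 0 1) \<and>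
    (\<forall>z. norm z \<le> 1 \<longrightarrow> f (F z) - f (F w) = (z - w) *\<^sub>C D z)"
    using a(1) by (intro exI[of _ "\<lambda>z. f (D z)"] exI[of _ "f d"])
      (auto intro: clin_tendsto simp: clin_scaleC[symmetric] clin_diff[symmetric])
qed

lemma disc_holomorphic_ident_scale: "disc_holomorphic F \<Longrightarrow> disc_holomorphic (\<lambda>z. z *\<^sub>C F z)"
proof (rule disc_holomorphicI)
  fix w :: complex assume a: "disc_holomorphic F" "norm w \<le> 1"
  obtain D d where "(D \<longlongrightarrow> d) (at w within cball 0 1)"
    "\<And>z. norm z \<le> 1 \<Longrightarrow> F z - F w = (z - w) *\<^sub>C D z"
    using disc_holomorphicE[OF a] by metis
  moreover have "z *\<^sub>C F z - w *\<^sub>C F w = z *\<^sub>C (F z - F w) + (z - w) *\<^sub>C F w" for z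
    by (simp add: scaleC_distribs)
  ultimately show "\<exists>D d. (D \<longlongrightarrow> d) (at w within cball 0 1) \<and>
    (\<forall>z. norm z \<le> 1 \<longrightarrow> z *\<^sub>C F z - w *\<^sub>C F w = (z - w) *\<^sub>C D z)"
    by (intro exI[of _ "\<lambda>z. z *\<^sub>C D z + F w"] exI[of _ "w *\<^sub>C d + F w"])
      (auto intro!: tendsto_intros tendsto_scaleC simp: scaleC_add_right scaleC_scaleC mult.commute)
qed

lemma filterlim_cnj_cball:
  "filterlim cnj (at (cnj w) within cball 0 1) (at w within cball 0 1)"
  unfolding filterlim_at
  by (auto simp: eventually_at_filter intro!: tendsto_intros always_eventually)

text \<open>Conjugating the argument of the second factor compensates the antilinearity of the inner product
  there. This is why the transforms below are resolvents taken at the conjugate point.\<close>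

lemma holomorphic_cinner_cnj:
  assumes "disc_holomorphic F" "disc_holomorphic H"
  shows "(\<lambda>z. cinner (F z) (H (cnj z))) holomorphic_on cball 0 1"
  unfolding holomorphic_on_def field_differentiable_def has_field_derivative_iff
proof
  fix w :: complex assume "w \<in> cball 0 1"
  then have w: "norm w \<le> 1" "norm (cnj w) \<le> 1" by auto
  obtain D d where D: "(D \<longlongrightarrow> d) (at w within cball 0 1)"
    "\<And>z. norm z \<le> 1 \<Longrightarrow> F z - F w = (z - w) *\<^sub>C D z"
    using disc_holomorphicE[OF assms(1) w(1)] by metis
  obtain D' d' where D': "(D' \<longlongrightarrow> d') (at (cnj w) within cball 0 1)"
    "\<And>z. norm z \<le> 1 \<Longrightarrow> H z - H (cnj w) = (z - cnj w) *\<^sub>C D' z"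
    using disc_holomorphicE[OF assms(2) w(2)] by metis
  have eq: "(cinner (F z) (H (cnj z)) - cinner (F w) (H (cnj w))) / (z - w)
      = cinner (D z) (H (cnj z)) + cinner (F w) (D' (cnj z))" if "norm z \<le> 1" "z \<noteq> w" for z
  proof -
    have "cinner (F z) (H (cnj z)) - cinner (F w) (H (cnj w))
        = cinner (F z - F w) (H (cnj z)) + cinner (F w) (H (cnj z) - H (cnj w))"
      by (simp add: cinner_distribs)
    also have "\<dots> = (z - w) * (cinner (D z) (H (cnj z)) + cinner (F w) (D' (cnj z)))"
      using that D(2)[of z] D'(2)[of "cnj z"] by (simp add: cinner_distribs algebra_simps)
    finally show ?thesis using that by simp
  qed
  have "((\<lambda>z. cinner (D z) (H (cnj z)) + cinner (F w) (D' (cnj z)))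
      \<longlongrightarrow> cinner d (H (cnj w)) + cinner (F w) d') (at w within cball 0 1)"
    by (intro tendsto_intros tendsto_cinner D(1) filterlim_compose[OF _ filterlim_cnj_cball]
        D'(1) disc_holomorphic_tendsto[OF assms(2)] w)
  moreover have "eventually (\<lambda>z. cinner (D z) (H (cnj z)) + cinner (F w) (D' (cnj z)) =
      (cinner (F z) (H (cnj z)) - cinner (F w) (H (cnj w))) / (z - w)) (at w within cball 0 1)"
    unfolding eventually_at_filter by (intro always_eventually) (simp add: eq)
  ultimately have "((\<lambda>z. (cinner (F z) (H (cnj z)) - cinner (F w) (H (cnj w))) / (z - w))
      \<longlongrightarrow> cinner d (H (cnj w)) + cinner (F w) d') (at w within cball 0 1)"
    by (rule Lim_transform_eventually)
  then show "\<exists>f'. ((\<lambda>z. (cinner (F z) (H (cnj z)) - cinner (F w) (H (cnj w))) / (z - w))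
      \<longlongrightarrow> f') (at w within cball 0 1)" ..
qed

text \<open>A pencil \<open>G - z K\<close> that is uniformly coercive on the closed disc. Its resolvent is bounded
  uniformly in \<open>z\<close>, which is all that holomorphy up to the boundary needs.\<close>

locale coercive_pencil =
  fixes G K :: "'a::complex_hilbert \<Rightarrow> 'a" and c :: real
  assumes clin_G: "clin G" and clin_K: "clin K" and c_pos: "c > 0"
    and coercive: "\<And>z h. norm z \<le> 1 \<Longrightarrow> c * (norm h)\<^sup>2 \<le> Re (cinner (G h - z *\<^sub>C K h) h)"
begin

definition res :: "complex \<Rightarrow> 'a \<Rightarrow> 'a"
  where "res z = inv (\<lambda>x. G x - z *\<^sub>C K x)"

lemma clin_pencil: "clin (\<lambda>x. G x - z *\<^sub>C K x)"
  by (rule clin_sub[OF clin_G clin_scale[OF clin_K]])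

lemma clin_res: "norm z \<le> 1 \<Longrightarrow> clin (res z)"
  unfolding res_def by (rule coercive_bij(2)[OF clin_pencil c_pos coercive])

lemma norm_res: "norm z \<le> 1 \<Longrightarrow> norm (res z x) \<le> norm x / c"
  unfolding res_def by (rule coercive_bij(3)[OF clin_pencil c_pos coercive])

lemma bij_pencil: "norm z \<le> 1 \<Longrightarrow> bij (\<lambda>x. G x - z *\<^sub>C K x)"
  by (rule coercive_bij(1)[OF clin_pencil c_pos coercive])

lemma pencil_res: "norm z \<le> 1 \<Longrightarrow> G (res z x) - z *\<^sub>C K (res z x) = x"
  using bij_is_surj[OF bij_pencil, of z] surj_f_inv_f[of "\<lambda>x. G x - z *\<^sub>C K x"] by (simp add: res_def)

lemma res_pencil: "norm z \<le> 1 \<Longrightarrow> res z (G x - z *\<^sub>C K x) = x"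
  using bij_is_inj[OF bij_pencil, of z] inv_f_f[of "\<lambda>x. G x - z *\<^sub>C K x"] by (simp add: res_def)

text \<open>The resolvent identity, with different right-hand sides at the two points. Continuity and
  differentiability of the resolvent are both read off from it.\<close>

lemma res_diff:
  assumes z: "norm z \<le> 1" and w: "norm w \<le> 1"
  shows "res z u - res w v = res z (u - v + (z - w) *\<^sub>C K (res w v))"
proof -
  have "G (res z u - res w v) - z *\<^sub>C K (res z u - res w v)
      = (G (res z u) - z *\<^sub>C K (res z u)) - (G (res w v) - w *\<^sub>C K (res w v)) + (z - w) *\<^sub>C K (res w v)"
    by (simp add: clin_diff[OF clin_G] clin_diff[OF clin_K] scaleC_distribs)
  also have "\<dots> = u - v + (z - w) *\<^sub>C K (res w v)"
    by (simp add: pencil_res z w)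
  finally show ?thesis using res_pencil[OF z] by metis
qed

lemma tendsto_res:
  assumes w: "norm w \<le> 1" and u: "(u \<longlongrightarrow> u0) (at w within cball 0 1)"
  shows "((\<lambda>z. res z (u z)) \<longlongrightarrow> res w u0) (at w within cball 0 1)"
proof (rule LIM_zero_cancel, rule tendsto_0_le)
  have "((\<lambda>z. u z - u0 + (z - w) *\<^sub>C K (res w u0)) \<longlongrightarrow> u0 - u0 + (w - w) *\<^sub>C K (res w u0))
      (at w within cball 0 1)"
    by (intro tendsto_intros tendsto_scaleC u)
  then show "((\<lambda>z. u z - u0 + (z - w) *\<^sub>C K (res w u0)) \<longlongrightarrow> 0) (at w within cball 0 1)"
    by simp
  show "\<forall>\<^sub>F z in at w within cball 0 1. norm (res z (u z) - res w u0)
      \<le> norm (u z - u0 + (z - w) *\<^sub>C K (res w u0)) * (1 / c)"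
    unfolding eventually_at_filter using norm_res w
    by (intro always_eventually) (simp add: res_diff)
qed

lemma disc_holomorphic_res:
  assumes F: "disc_holomorphic F"
  shows "disc_holomorphic (\<lambda>z. res z (F z))"
proof (rule disc_holomorphicI)
  fix w :: complex assume w: "norm w \<le> 1"
  obtain D d where D: "(D \<longlongrightarrow> d) (at w within cball 0 1)"
    "\<And>z. norm z \<le> 1 \<Longrightarrow> F z - F w = (z - w) *\<^sub>C D z"
    using disc_holomorphicE[OF F w] by metis
  show "\<exists>D d. (D \<longlongrightarrow> d) (at w within cball 0 1) \<and>
    (\<forall>z. norm z \<le> 1 \<longrightarrow> res z (F z) - res w (F w) = (z - w) *\<^sub>C D z)"
  proof (intro exI conjI allI impI)
    show "((\<lambda>z. res z (D z + K (res w (F w)))) \<longlongrightarrow> res w (d + K (res w (F w)))) (at w within cball 0 1)"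
      by (intro tendsto_res tendsto_intros w D(1))
    fix z :: complex assume z: "norm z \<le> 1"
    have "res z (F z) - res w (F w) = res z ((z - w) *\<^sub>C (D z + K (res w (F w))))"
      by (simp add: res_diff[OF z w] D(2)[OF z] scaleC_add_right)
    also have "\<dots> = (z - w) *\<^sub>C res z (D z + K (res w (F w)))"
      by (rule clin_scaleC[OF clin_res[OF z]])
    finally show "res z (F z) - res w (F w) = (z - w) *\<^sub>C res z (D z + K (res w (F w)))" .
  qed
qed

end


section \<open>Equivalent inner products and the boundary transform\<close>

text \<open>The inner products \<open>\<langle>D u, v\<rangle>\<close> equivalent to the given one. Apart from the original one they
  serve for the defect operators \<open>1 - T\<^sub>j\<^sup>* T\<^sub>j\<close>; working with forms avoids square roots of these.\<close>

locale pos_op =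
  fixes D :: "'a::complex_hilbert \<Rightarrow> 'a" and c :: real
  assumes clin_D: "clin D" and D_sym: "\<And>x y. cinner (D x) y = cinner x (D y)"
    and c_pos: "c > 0" and D_pos: "\<And>x. c * (norm x)\<^sup>2 \<le> Re (cinner (D x) x)"
begin

definition Q :: "'a \<Rightarrow> 'a \<Rightarrow> complex"
  where "Q u v = cinner (D u) v"

lemma Q_commute: "Q v u = cnj (Q u v)"
  by (metis Q_def D_sym cinner_commute)

lemma Q_simps:
  "Q (x + y) z = Q x z + Q y z" "Q x (y + z) = Q x y + Q x z"
  "Q (x - y) z = Q x z - Q y z" "Q x (y - z) = Q x y - Q x z"
  "Q (a *\<^sub>C x) z = a * Q x z" "Q x (a *\<^sub>C z) = cnj a * Q x z"
  by (simp_all add: Q_def clin_add[OF clin_D] clin_diff[OF clin_D] clin_scaleC[OF clin_D] cinner_distribs)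

lemma Q_nonneg: "0 \<le> Re (Q x x)"
  using D_pos[of x] c_pos by (auto simp: Q_def intro: order_trans[rotated])

lemma Re_Q_le: "Re (Q u v) \<le> (Re (Q u u) + Re (Q v v)) / 2"
  using Q_nonneg[of "u - v"] Q_commute[of v u] by (simp add: Q_simps)

lemma D_inj: "D x = D y \<Longrightarrow> x = y"
proof -
  assume "D x = D y"
  then have "c * (norm (x - y))\<^sup>2 \<le> Re (cinner 0 (x - y))"
    using D_pos[of "x - y"] by (simp add: clin_diff[OF clin_D])
  then have "c * (norm (x - y))\<^sup>2 \<le> 0" using cinner_scaleC_left[of 0 0 "x - y"] by simp
  then show ?thesis using c_pos by (simp add: mult_le_0_iff)
qed

end

text \<open>Strictness of the contraction makes \<open>1 - z T\<close> invertible on the closed disc, its boundary included.\<close>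

locale form_contraction = pos_op +
  fixes T :: "'a \<Rightarrow> 'a" and r :: real
  assumes clin_T: "clin T" and r: "0 < r" "r < 1"
    and T_contr: "\<And>u. Re (Q (T u) (T u)) \<le> r\<^sup>2 * Re (Q u u)"
begin

sublocale pencil: coercive_pencil D "\<lambda>x. D (T x)" "(1 - r) * c"
proof
  show "clin D" by (rule clin_D)
  show "clin (\<lambda>x. D (T x))" by (rule clin_compose[OF clin_D clin_T])
  show "0 < (1 - r) * c" using r c_pos by simp
  fix z :: complex and h assume z: "norm z \<le> 1"
  \<comment> \<open>the factor \<open>1 / r\<close> makes both terms of the mean comparable to \<open>Q h h\<close>\<close>
  have "Re (Q ((z / r) *\<^sub>C T h) h) \<le> (Re (Q ((z / r) *\<^sub>C T h) ((z / r) *\<^sub>C T h)) + Re (Q h h)) / 2"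
    by (rule Re_Q_le)
  moreover have "Re (Q ((z / r) *\<^sub>C T h) ((z / r) *\<^sub>C T h)) \<le> Re (Q h h)"
  proof -
    have "Q ((z / r) *\<^sub>C T h) ((z / r) *\<^sub>C T h) = complex_of_real ((norm (z / r))\<^sup>2) * Q (T h) (T h)"
      unfolding complex_norm_square by (simp add: Q_simps)
    then have "Re (Q ((z / r) *\<^sub>C T h) ((z / r) *\<^sub>C T h)) = (norm z)\<^sup>2 / r\<^sup>2 * Re (Q (T h) (T h))"
      using r by (simp add: norm_divide power_divide)
    also have "\<dots> \<le> 1 / r\<^sup>2 * (r\<^sup>2 * Re (Q h h))"
      using z r T_contr[of h] Q_nonneg by (intro mult_mono divide_right_mono) (auto simp: power_le_one)
    finally show ?thesis using r by simp
  qed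
  ultimately have "Re (Q ((z / r) *\<^sub>C T h) h) \<le> Re (Q h h)" by simp
  then have "Re (Q (z *\<^sub>C T h) h) \<le> r * Re (Q h h)"
    using r by (simp add: Q_simps field_simps)
  then have "(1 - r) * Re (Q h h) \<le> Re (Q h h - z * Q (T h) h)"
    by (simp add: Q_simps algebra_simps)
  moreover have "(1 - r) * c * (norm h)\<^sup>2 \<le> (1 - r) * Re (Q h h)"
    using D_pos[of h] r by (simp add: Q_def mult.assoc)
  ultimately show "(1 - r) * c * (norm h)\<^sup>2 \<le> Re (cinner (D h - z *\<^sub>C D (T h)) h)"
    by (simp add: Q_def cinner_distribs)
qed

text \<open>\<open>hat z\<close> is the resolvent \<open>(1 - z T)\<^sup>-\<^sup>1\<close>. The factor \<open>D\<close> on both sides of the equation turns coercivity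
  for the form into coercivity for the original inner product, in which the inverse is constructed.\<close>

definition hat :: "complex \<Rightarrow> 'a \<Rightarrow> 'a"
  where "hat z h = pencil.res z (D h)"

lemma clin_hat: "norm z \<le> 1 \<Longrightarrow> clin (hat z)"
  unfolding hat_def[abs_def] by (rule clin_compose[OF pencil.clin_res clin_D])

lemma disc_holomorphic_hat: "disc_holomorphic (\<lambda>z. hat z h)"
  unfolding hat_def by (intro pencil.disc_holomorphic_res disc_holomorphic_const)

lemma hat_eq: assumes "norm z \<le> 1" shows "hat z h - z *\<^sub>C T (hat z h) = h"
  by (rule D_inj) (use pencil.pencil_res[OF assms, of "D h"] in
      \<open>simp add: hat_def clin_diff[OF clin_D] clin_scaleC[OF clin_D]\<close>)

lemma hat_unique: "norm z \<le> 1 \<Longrightarrow> u - z *\<^sub>C T u = h \<Longrightarrow> hat z h = u"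
  using pencil.res_pencil[of z u]
  by (auto simp: hat_def clin_diff[OF clin_D] clin_scaleC[OF clin_D])

lemma hat_commute:
  assumes S: "clin S" "\<And>x. S (T x) = T (S x)" and z: "norm z \<le> 1"
  shows "hat z (S h) = S (hat z h)"
proof (rule hat_unique[OF z])
  show "S (hat z h) - z *\<^sub>C T (S (hat z h)) = S h"
    using arg_cong[OF hat_eq[OF z, of h], of S]
    by (simp add: S clin_diff[OF S(1)] clin_scaleC[OF S(1)])
qed

lemma hat_zero: "hat 0 h = h"
  using hat_eq[of 0 h] by simp

text \<open>The defect form of \<open>T\<close>. The mean of \<open>E\<close> over the circle, taken on the functions
  \<open>hat (cnj z) u\<close>, is \<open>Q\<close>.\<close>

definition E :: "'a \<Rightarrow> 'a \<Rightarrow> complex"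
  where "E u v = Q u v - Q (T u) (T v)"

lemma E_simps:
  "E (x + y) z = E x z + E y z" "E (a *\<^sub>C x) z = a * E x z" "E x (a *\<^sub>C z) = cnj a * E x z"
  "E (x - y) z = E x z - E y z" "E x (y - z) = E x y - E x z"
  by (simp_all add: E_def clin_add[OF clin_T] clin_diff[OF clin_T] clin_scaleC[OF clin_T] Q_simps algebra_simps)

lemma E_nonneg: "0 \<le> Re (E x x)"
proof -
  have "r\<^sup>2 * Re (Q x x) \<le> 1 * Re (Q x x)"
    using r by (intro mult_right_mono Q_nonneg) (auto simp: power_le_one)
  then show ?thesis using T_contr[of x] by (simp add: E_def)
qed

lemma E_commute: "E v u = cnj (E u v)"
  unfolding E_def by (metis Q_commute complex_cnj_diff)

text \<open>On the unit circle \<open>T (hat u) = z (hat u - u)\<close>, so the form \<open>E\<close> between two boundary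
  transforms depends on each of them affinely.\<close>

lemma E_hat:
  assumes z: "norm z = 1"
  shows "E (hat (cnj z) u) (hat (cnj z) v) = Q (hat (cnj z) u) v + Q u (hat (cnj z) v) - Q u v"
proof -
  have zz: "z * cnj z = 1" using z by (simp add: complex_norm_square[symmetric])
  have T: "T (hat (cnj z) u) = z *\<^sub>C (hat (cnj z) u - u)" for u
  proof -
    have "hat (cnj z) u - u = cnj z *\<^sub>C T (hat (cnj z) u)"
      using hat_eq[of "cnj z" u] z by (simp add: algebra_simps)
    then show ?thesis by (simp add: scaleC_scaleC zz)
  qed
  have "Q (T (hat (cnj z) u)) (T (hat (cnj z) v)) = (z * cnj z) * Q (hat (cnj z) u - u) (hat (cnj z) v - v)"
    unfolding T by (simp only: Q_simps(5,6) ac_simps)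
  then show ?thesis by (simp add: E_def zz Q_simps)
qed

text \<open>\<open>Y\<close> represents \<open>g\<close> on the circle up to an analytic function vanishing at the centre. Such functions
  are orthogonal in the mean to all \<open>hat (cnj z) k\<close>, whose Fourier coefficients of positive
  index vanish.\<close>

definition analytic_lift :: "(complex \<Rightarrow> 'a) \<Rightarrow> 'a \<Rightarrow> bool"
  where "analytic_lift Y g \<longleftrightarrow>
    (\<exists>F. disc_holomorphic F \<and> (\<forall>z. norm z = 1 \<longrightarrow> Y z = hat (cnj z) g + z *\<^sub>C F z))"

lemma lift_hat: "analytic_lift (\<lambda>z. hat (cnj z) h) h"
  unfolding analytic_lift_def by (rule exI[of _ "\<lambda>z. 0"]) (simp add: disc_holomorphic_const)

lemma lift_add:
  assumes "analytic_lift Y g" "analytic_lift Y' g'"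
  shows "analytic_lift (\<lambda>z. Y z + Y' z) (g + g')"
proof -
  obtain F F' where "disc_holomorphic F" "\<forall>z. norm z = 1 \<longrightarrow> Y z = hat (cnj z) g + z *\<^sub>C F z"
    "disc_holomorphic F'" "\<forall>z. norm z = 1 \<longrightarrow> Y' z = hat (cnj z) g' + z *\<^sub>C F' z"
    using assms unfolding analytic_lift_def by blast
  then show ?thesis unfolding analytic_lift_def
    by (intro exI[of _ "\<lambda>z. F z + F' z"])
      (auto simp: disc_holomorphic_add scaleC_add_right clin_add[OF clin_hat])
qed

lemma lift_scale:
  assumes "analytic_lift Y g"
  shows "analytic_lift (\<lambda>z. a *\<^sub>C Y z) (a *\<^sub>C g)"
proof -
  obtain F where "disc_holomorphic F" "\<forall>z. norm z = 1 \<longrightarrow> Y z = hat (cnj z) g + z *\<^sub>C F z"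
    using assms unfolding analytic_lift_def by blast
  then show ?thesis unfolding analytic_lift_def
    by (intro exI[of _ "\<lambda>z. a *\<^sub>C F z"])
      (auto simp: disc_holomorphic_clin[OF clin_scale[OF clin_id]] scaleC_add_right clin_scaleC[OF clin_hat]
        scaleC_scaleC mult.commute)
qed

lemma lift_zero: "analytic_lift (\<lambda>z. 0) 0"
  unfolding analytic_lift_def
  by (rule exI[of _ "\<lambda>z. 0"]) (simp add: disc_holomorphic_const clin_zero[OF clin_hat])

lemma lift_sum:
  assumes "finite I" "\<And>i. i \<in> I \<Longrightarrow> analytic_lift (Y i) (g i)"
  shows "analytic_lift (\<lambda>z. \<Sum>i\<in>I. Y i z) (\<Sum>i\<in>I. g i)"
  using assms by (induction I rule: finite_induct) (auto simp: lift_zero intro: lift_add)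

text \<open>Multiplication by \<open>z\<close> sends the Fourier coefficient of index \<open>0\<close> into the analytic part and shifts
  the others, exactly as \<open>T\<close> shifts the sequence of vectors \<open>T\<^sup>n g\<close>.\<close>

lemma lift_shift:
  assumes "analytic_lift Y g"
  shows "analytic_lift (\<lambda>z. z *\<^sub>C Y z) (T g)"
proof -
  obtain F where F: "disc_holomorphic F" "\<And>z. norm z = 1 \<Longrightarrow> Y z = hat (cnj z) g + z *\<^sub>C F z"
    using assms unfolding analytic_lift_def by blast
  have "z *\<^sub>C Y z = hat (cnj z) (T g) + z *\<^sub>C (g + z *\<^sub>C F z)" if z: "norm z = 1" for z
  proof -
    have zz: "z * cnj z = 1" using z by (simp add: complex_norm_square[symmetric])
    have "z *\<^sub>C hat (cnj z) g = z *\<^sub>C (hat (cnj z) g - cnj z *\<^sub>C T (hat (cnj z) g)) + T (hat (cnj z) g)"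
      by (simp add: scaleC_distribs zz)
    also have "\<dots> = z *\<^sub>C g + hat (cnj z) (T g)"
      using z by (simp add: hat_eq hat_commute[OF clin_T])
    finally show ?thesis by (simp add: F(2)[OF z] scaleC_add_right)
  qed
  then show ?thesis unfolding analytic_lift_def
    using F(1) by (intro exI[of _ "\<lambda>z. g + z *\<^sub>C F z"]) (auto intro: disc_holomorphic_add disc_holomorphic_const disc_holomorphic_ident_scale)
qed

lemma lift_shift_power: "analytic_lift Y g \<Longrightarrow> analytic_lift (\<lambda>z. z ^ n *\<^sub>C Y z) ((T ^^ n) g)"
proof (induction n)
  case (Suc n)
  then show ?case using lift_shift[of "\<lambda>z. z ^ n *\<^sub>C Y z"] by (simp add: scaleC_scaleC)
qed simp

lemma holomorphic_Q:
  assumes "disc_holomorphic F" "disc_holomorphic H"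
  shows "(\<lambda>z. Q (F z) (H (cnj z))) holomorphic_on cball 0 1"
  unfolding Q_def by (rule holomorphic_cinner_cnj[OF disc_holomorphic_clin[OF clin_D assms(1)] assms(2)])

text \<open>The minimum principle turns an inequality between boundary transforms on the circle into
  the same inequality between the vectors themselves: on the circle both sides are real parts of functions
  holomorphic in the disc and continuous up to its boundary. At the centre the transform is the identity,
  and the analytic part of \<open>Y\<close> drops out.\<close>

lemma boundary_estimate:
  assumes lift: "analytic_lift Y g"
    and le: "\<And>z. norm z = 1 \<Longrightarrow> Re (E (Y z) (hat (cnj z) k))
      \<le> s / 2 * (Re (E (hat (cnj z) h) (hat (cnj z) h)) + Re (E (hat (cnj z) k) (hat (cnj z) k)))"
  shows "Re (Q g k) \<le> s / 2 * (Re (Q h h) + Re (Q k k))"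
proof -
  obtain F where F: "disc_holomorphic F" "\<And>z. norm z = 1 \<Longrightarrow> Y z = hat (cnj z) g + z *\<^sub>C F z"
    using lift unfolding analytic_lift_def by blast
  \<comment> \<open>on the circle the real part of \<open>\<phi>\<close> is the left-hand side minus the right-hand side of the
    hypothesis; terms antiholomorphic in \<open>z\<close> are replaced by their conjugates\<close>
  define \<phi> where "\<phi> z = Q g (hat (cnj z) k) + Q k (hat (cnj z) g) - Q g k
    + z * (Q (F z) (hat (cnj z) k) - Q (T (F z)) (T (hat (cnj z) k)))
    - complex_of_real (s / 2) * (2 * Q h (hat (cnj z) h) - Q h h + (2 * Q k (hat (cnj z) k) - Q k k))" for z
  have hol: "\<phi> holomorphic_on cball 0 1"
    unfolding \<phi>_def
    by (intro holomorphic_intros holomorphic_Q[OF disc_holomorphic_const] holomorphic_Q[OF F(1)]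
        holomorphic_Q[OF disc_holomorphic_clin[OF clin_T F(1)] disc_holomorphic_clin[OF clin_T disc_holomorphic_hat]] disc_holomorphic_hat)
  have "Re (\<phi> 0) \<le> 0"
  proof (rule maximum_real_frontier[where S = "ball 0 1" and f = \<phi> and \<xi> = 0])
    show "\<phi> holomorphic_on interior (ball 0 1)"
      by (rule holomorphic_on_subset[OF hol]) auto
    show "continuous_on (closure (ball 0 1)) \<phi>"
      using holomorphic_on_imp_continuous_on[OF hol] by simp
    fix z :: complex assume "z \<in> frontier (ball 0 1)"
    then have z: "norm z = 1" by simp
    have "Re (E (Y z) (hat (cnj z) k)) = Re (Q g (hat (cnj z) k)) + Re (Q k (hat (cnj z) g)) - Re (Q g k)
        + Re (z * (Q (F z) (hat (cnj z) k) - Q (T (F z)) (T (hat (cnj z) k))))"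
      using Q_commute[of "hat (cnj z) g" k] by (simp add: F(2)[OF z] E_simps E_hat[OF z]) (simp add: E_def)
    moreover have "Re (E (hat (cnj z) x) (hat (cnj z) x)) = Re (2 * Q x (hat (cnj z) x) - Q x x)" for x
      using Q_commute[of "hat (cnj z) x" x] by (simp add: E_hat[OF z])
    ultimately show "Re (\<phi> z) \<le> 0"
      using le[OF z] by (simp add: \<phi>_def)
  qed auto
  moreover have "Re (\<phi> 0) = Re (Q g k) - s / 2 * (Re (Q h h) + Re (Q k k))"
    using Q_commute[of k g] by (simp add: \<phi>_def hat_zero)
  ultimately show ?thesis by simp
qed

lemma Re_E_le: "Re (E u v) \<le> (Re (E u u) + Re (E v v)) / 2"
  using E_nonneg[of "u - v"] E_commute[of v u] by (simp add: E_simps)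

text \<open>The Cauchy-Schwarz inequality combined with that of the arithmetic and geometric means. This
  additive form is the one that the boundary estimate takes in and gives back.\<close>

lemma Re_scale_E_le:
  assumes "norm a \<le> s"
  shows "Re (a * E u v) \<le> s / 2 * (Re (E u u) + Re (E v v))"
proof -
  define b where "b = (if a = 0 then 1 else a / norm a)"
  have b: "norm b = 1" "a = complex_of_real (norm a) * b"
    by (auto simp: b_def norm_divide)
  have "E (b *\<^sub>C u) (b *\<^sub>C u) = E u u"
    using complex_norm_square[of b] b(1) by (simp add: E_simps mult.assoc[symmetric] mult.commute[of "cnj b"])
  then have "Re (E (b *\<^sub>C u) v) \<le> (Re (E u u) + Re (E v v)) / 2"
    using Re_E_le[of "b *\<^sub>C u" v] by simp
  then have "norm a * Re (b * E u v) \<le> norm a * ((Re (E u u) + Re (E v v)) / 2)"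
    by (intro mult_left_mono) (auto simp: E_simps)
  also have "\<dots> \<le> s * ((Re (E u u) + Re (E v v)) / 2)"
    using E_nonneg[of u] E_nonneg[of v] by (intro mult_right_mono assms) auto
  finally show ?thesis by (subst b(2)) (simp add: mult.assoc)
qed

text \<open>A polynomial in \<open>T\<close> is represented by the scalar polynomial times the transform, so the pointwise
  bound is just the bound of a scalar multiple.\<close>

lemma strict_von_neumann:
  assumes I: "finite I" and s: "\<And>w. norm w = 1 \<Longrightarrow> norm (\<Sum>i\<in>I. d i * w ^ e i) \<le> s"
  shows "Re (Q (\<Sum>i\<in>I. d i *\<^sub>C (T ^^ e i) h) k) \<le> s / 2 * (Re (Q h h) + Re (Q k k))"
proof (rule boundary_estimate)
  show "analytic_lift (\<lambda>z. \<Sum>i\<in>I. d i *\<^sub>C (z ^ e i *\<^sub>C hat (cnj z) h)) (\<Sum>i\<in>I. d i *\<^sub>C (T ^^ e i) h)"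
    by (intro lift_sum I lift_scale lift_shift_power lift_hat)
  fix z :: complex assume z: "norm z = 1"
  have "E (\<Sum>i\<in>I. d i *\<^sub>C (z ^ e i *\<^sub>C u)) v = (\<Sum>i\<in>I. d i * z ^ e i) * E u v" for u v
    by (simp add: scaleC_scaleC scaleC_sum_left[symmetric] E_simps)
  then show "Re (E (\<Sum>i\<in>I. d i *\<^sub>C (z ^ e i *\<^sub>C hat (cnj z) h)) (hat (cnj z) k))
      \<le> s / 2 * (Re (E (hat (cnj z) h) (hat (cnj z) h)) + Re (E (hat (cnj z) k) (hat (cnj z) k)))"
    using Re_scale_E_le[OF s[OF z]] by simp
qed

end


section \<open>The inequalities of von Neumann and Ando\<close>

lemma clin_scaled_power:
  assumes "clin f"
  shows "((\<lambda>x. a *\<^sub>C f x) ^^ n) x = a ^ n *\<^sub>C (f ^^ n) x"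
  by (induction n) (simp_all add: clin_scaleC[OF assms] scaleC_scaleC)

lemma cinner_sum_left: "cinner (sum f A) y = (\<Sum>i\<in>A. cinner (f i) y)" for y :: "'a::complex_hilbert"
  using bounded_linear.linear[OF bounded_bilinear.bounded_linear_left[OF bounded_bilinear_cinner]]
  by (rule linear_sum)

context pos_op
begin

lemma Q_sum: "Q (\<Sum>i\<in>I. a i *\<^sub>C x i) y = (\<Sum>i\<in>I. a i * Q (x i) y)"
  by (simp add: Q_def clin_sum[OF clin_D] clin_scaleC[OF clin_D] cinner_sum_left cinner_scaleC_left)

lemma Re_scale_Q_le:
  assumes "norm a \<le> 1"
  shows "Re (a * Q u v) \<le> (Re (Q u u) + Re (Q v v)) / 2"
proof -
  have "Q (a *\<^sub>C u) (a *\<^sub>C u) = complex_of_real ((norm a)\<^sup>2) * Q u u"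
    unfolding complex_norm_square by (simp add: Q_simps)
  then have "Re (Q (a *\<^sub>C u) (a *\<^sub>C u)) = (norm a)\<^sup>2 * Re (Q u u)"
    by simp
  also have "\<dots> \<le> 1 * Re (Q u u)"
    using assms by (intro mult_right_mono Q_nonneg) (simp add: power_le_one)
  finally show ?thesis using Re_Q_le[of "a *\<^sub>C u" v] by (simp add: Q_simps)
qed

text \<open>Von Neumann's inequality in the inner product \<open>Q\<close>, from strict contractions \<open>t C\<close> by letting \<open>t\<close>
  tend to \<open>1\<close>. It is needed for a general \<open>Q\<close> because the values of \<open>Phi\<close> below are
  contractions for the defect form of \<open>T\<^sub>1\<close>.\<close>

lemma von_neumann:
  assumes C: "clin C" "\<And>u. Re (Q (C u) (C u)) \<le> Re (Q u u)"
    and I: "finite I" and s: "\<And>w. norm w = 1 \<Longrightarrow> norm (\<Sum>i\<in>I. d i * w ^ e i) \<le> s"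
  shows "Re (Q (\<Sum>i\<in>I. d i *\<^sub>C (C ^^ e i) h) k) \<le> s / 2 * (Re (Q h h) + Re (Q k k))"
proof -
  have strict: "Re (\<Sum>i\<in>I. d i * (complex_of_real t ^ e i * Q ((C ^^ e i) h) k)) \<le> s / 2 * (Re (Q h h) + Re (Q k k))"
    if t: "0 < t" "t < 1" for t
  proof -
    interpret C: form_contraction D c "\<lambda>x. complex_of_real t *\<^sub>C C x" t
    proof
      show "clin (\<lambda>x. complex_of_real t *\<^sub>C C x)" by (rule clin_scale[OF C(1)])
      show "Re (Q (complex_of_real t *\<^sub>C C u) (complex_of_real t *\<^sub>C C u)) \<le> t\<^sup>2 * Re (Q u u)" for u
        using mult_left_mono[OF C(2)[of u], of "t\<^sup>2"] by (simp add: Q_simps power2_eq_square)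
    qed (use t in auto)
    show ?thesis
      using C.strict_von_neumann[OF I s, where h = h and k = k]
      by (simp add: clin_scaled_power[OF C(1)] Q_sum Q_simps(5))
  qed
  have "((\<lambda>t. Re (\<Sum>i\<in>I. d i * (complex_of_real t ^ e i * Q ((C ^^ e i) h) k)))
      \<longlongrightarrow> Re (\<Sum>i\<in>I. d i * (complex_of_real 1 ^ e i * Q ((C ^^ e i) h) k))) (at_left 1)"
    by (intro tendsto_intros)
  then have "Re (\<Sum>i\<in>I. d i * (complex_of_real 1 ^ e i * Q ((C ^^ e i) h) k)) \<le> s / 2 * (Re (Q h h) + Re (Q k k))"
  proof (rule tendsto_upperbound)
    show "\<forall>\<^sub>F t in at_left 1. Re (\<Sum>i\<in>I. d i * (complex_of_real t ^ e i * Q ((C ^^ e i) h) k))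
        \<le> s / 2 * (Re (Q h h) + Re (Q k k))"
      using eventually_at_left_real[of 0 1, OF zero_less_one]
      by (rule eventually_mono) (rule strict, auto)
  qed simp
  then show ?thesis by (simp add: Q_sum)
qed

end

definition adj :: "('a::complex_hilbert \<Rightarrow> 'a) \<Rightarrow> 'a \<Rightarrow> 'a"
  where "adj f = (SOME g. clin g \<and> (\<forall>x y. cinner (f x) y = cinner x (g y)))"

lemma
  assumes "clin f"
  shows clin_adj: "clin (adj f)"
    and cinner_adj_right: "cinner x (adj f y) = cinner (f x) y"
    and cinner_adj_left: "cinner (adj f y) x = cinner y (f x)"
proof -
  have *: "clin (adj f) \<and> (\<forall>x y. cinner (f x) y = cinner x (adj f y))"
    unfolding adj_def by (rule someI_ex[OF adjoint_exists[OF assms]])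
  then show "clin (adj f)" "cinner x (adj f y) = cinner (f x) y" by auto
  then show "cinner (adj f y) x = cinner y (f x)" using * by (metis cinner_commute)
qed

lemma pos_op_defect:
  assumes T: "clin T" "\<And>x. norm (T x) \<le> r * norm x" and r: "0 < r" "r < 1"
  shows "pos_op (\<lambda>x. x - adj T (T x)) (1 - r\<^sup>2)"
proof
  show "clin (\<lambda>x. x - adj T (T x))"
    by (rule clin_sub[OF clin_id clin_compose[OF clin_adj[OF T(1)] T(1)]])
  show "cinner (x - adj T (T x)) y = cinner x (y - adj T (T y))" for x y
    by (simp add: cinner_distribs cinner_adj_left[OF T(1)] cinner_adj_right[OF T(1)])
  show "0 < 1 - r\<^sup>2" using r by (simp add: power_less_one_iff abs_square_less_1)
  show "(1 - r\<^sup>2) * (norm x)\<^sup>2 \<le> Re (cinner (x - adj T (T x)) x)" for x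
    using power_mono[OF T(2)[of x], of 2]
    by (simp add: cinner_distribs cinner_adj_left[OF T(1)] Re_cinner_self power_mult_distrib algebra_simps)
qed

text \<open>The situation of Ando's inequality after scaling by a factor below \<open>1\<close>, which makes all resolvents
  exist up to the boundary of the disc.\<close>

locale strict_commuting_pair =
  fixes T1 T2 :: "'a::complex_hilbert \<Rightarrow> 'a" and r :: real
  assumes clin_T1: "clin T1" and clin_T2: "clin T2" and commute: "\<And>x. T1 (T2 x) = T2 (T1 x)"
    and r: "0 < r" "r < 1"
    and T1_le: "\<And>x. norm (T1 x) \<le> r * norm x" and T2_le: "\<And>x. norm (T2 x) \<le> r * norm x"
begin

sublocale d1: pos_op "\<lambda>x. x - adj T1 (T1 x)" "1 - r\<^sup>2"
  by (rule pos_op_defect[OF clin_T1 T1_le r])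

sublocale d2: pos_op "\<lambda>x. x - adj T2 (T2 x)" "1 - r\<^sup>2"
  by (rule pos_op_defect[OF clin_T2 T2_le r])

sublocale full: form_contraction "\<lambda>x. x" 1 T1 r
proof -
  interpret pos_op "\<lambda>x :: 'a. x" 1
    by unfold_locales (simp_all add: clin_id Re_cinner_self)
  show "form_contraction (\<lambda>x. x) 1 T1 r"
  proof
    show "Re (Q (T1 u) (T1 u)) \<le> r\<^sup>2 * Re (Q u u)" for u
      using power_mono[OF T1_le[of u], of 2] by (simp add: Q_def Re_cinner_self power_mult_distrib)
  qed (use clin_T1 r in auto)
qed

lemma d1_Q: "d1.Q u v = cinner u v - cinner (T1 u) (T1 v)"
  by (simp add: d1.Q_def cinner_distribs cinner_adj_left[OF clin_T1])

lemma d2_Q: "d2.Q u v = cinner u v - cinner (T2 u) (T2 v)"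
  by (simp add: d2.Q_def cinner_distribs cinner_adj_left[OF clin_T2])

lemma full_E: "full.E u v = d1.Q u v"
  by (simp add: full.E_def full.Q_def d1_Q)

text \<open>The pencil \<open>G - z K = 1 - (T\<^sub>1 T\<^sub>2)\<^sup>* (T\<^sub>1 T\<^sub>2) - z T\<^sub>1\<^sup>* D\<^sub>2\<close> comes from lurking isometries. The map
  \<open>(T\<^sub>1 h, h) \<mapsto> (T\<^sub>2 h, h)\<close> is isometric from the defect norms of \<open>(T\<^sub>2, T\<^sub>1)\<close> to those of \<open>(T\<^sub>1, T\<^sub>2)\<close>; composed
  with the orthogonal projection onto the graph of \<open>T\<^sub>1\<close> it becomes an everywhere defined contraction,
  and \<open>Phi\<close> is its transfer function. The normal equation of the projection,
  with \<open>z y\<close> fed back as its first argument, is the equation of the pencil.\<close>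

definition G :: "'a \<Rightarrow> 'a"
  where "G x = x - adj T1 (adj T2 (T2 (T1 x)))"

definition K :: "'a \<Rightarrow> 'a"
  where "K x = adj T1 (x - adj T2 (T2 x))"

text \<open>\<open>\<langle>G y, y\<rangle>\<close> equals \<open>\<parallel>y\<parallel>\<^sup>2 - \<parallel>T\<^sub>1 T\<^sub>2 y\<parallel>\<^sup>2\<close>, and the defect form of \<open>T\<^sub>2\<close> bounds the term with \<open>K\<close> by
  half the sum of its values at \<open>y\<close> and at \<open>T\<^sub>1 y\<close>. The estimate holds up to \<open>\<bar>z\<bar> = 1\<close> and serves both the
  invertibility of the pencil and the contractivity of \<open>Phi\<close>.\<close>

lemma Re_pencil:
  assumes "norm z \<le> 1"
  shows "Re (cinner (G y - z *\<^sub>C K y) y) \<ge> ((norm y)\<^sup>2 - (norm (T2 (T1 y)))\<^sup>2 + (norm (T2 y))\<^sup>2 - (norm (T1 y))\<^sup>2) / 2"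
proof -
  have "Re (cinner (G y - z *\<^sub>C K y) y) = (norm y)\<^sup>2 - (norm (T2 (T1 y)))\<^sup>2 - Re (z * d2.Q y (T1 y))"
    by (simp add: G_def K_def cinner_distribs cinner_adj_left clin_T1 clin_T2 Re_cinner_self d2.Q_def)
  moreover have "Re (z * d2.Q y (T1 y)) \<le> (Re (d2.Q y y) + Re (d2.Q (T1 y) (T1 y))) / 2"
    by (rule d2.Re_scale_Q_le[OF assms])
  ultimately show ?thesis by (simp add: d2_Q Re_cinner_self)
qed

sublocale pencil: coercive_pencil G K "(1 - r\<^sup>2) / 2"
proof
  show "clin G" unfolding G_def
    by (rule clin_sub[OF clin_id clin_compose[OF clin_adj[OF clin_T1]
        clin_compose[OF clin_adj[OF clin_T2] clin_compose[OF clin_T2 clin_T1]]]])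
  show "clin K" unfolding K_def
    by (rule clin_compose[OF clin_adj[OF clin_T1] d2.clin_D])
  show "0 < (1 - r\<^sup>2) / 2" using d1.c_pos by simp
  fix z :: complex and h :: 'a assume z: "norm z \<le> 1"
  have "norm (T2 (T1 h)) \<le> norm (T2 h)"
    using T1_le[of "T2 h"] r mult_right_mono[of r 1 "norm (T2 h)"] by (simp add: commute)
  then have "(norm (T2 (T1 h)))\<^sup>2 \<le> (norm (T2 h))\<^sup>2" by (rule power_mono) simp
  moreover have "(norm (T1 h))\<^sup>2 \<le> r\<^sup>2 * (norm h)\<^sup>2"
    using power_mono[OF T1_le[of h], of 2] by (simp add: power_mult_distrib)
  moreover have eq: "(1 - r\<^sup>2) / 2 * (norm h)\<^sup>2 = ((norm h)\<^sup>2 - r\<^sup>2 * (norm h)\<^sup>2) / 2"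
    by (simp add: algebra_simps)
  ultimately show "(1 - r\<^sup>2) / 2 * (norm h)\<^sup>2 \<le> Re (cinner (G h - z *\<^sub>C K h) h)"
    unfolding eq using Re_pencil[OF z, of h] by argo
qed

definition Phi :: "complex \<Rightarrow> 'a \<Rightarrow> 'a"
  where "Phi z v = T2 (pencil.res z (v - adj T1 (T1 v)))"

lemma clin_Phi: "norm z \<le> 1 \<Longrightarrow> clin (Phi z)"
  unfolding Phi_def[abs_def] by (intro clin_compose[OF clin_T2 clin_compose[OF pencil.clin_res d1.clin_D]])

lemma Phi_contraction:
  assumes z: "norm z \<le> 1"
  shows "Re (d1.Q (Phi z v) (Phi z v)) \<le> Re (d1.Q v v)"
proof -
  define y where "y = pencil.res z (v - adj T1 (T1 v))"
  have "Re (cinner (G y - z *\<^sub>C K y) y) = Re (d1.Q v y)"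
    by (simp add: y_def pencil.pencil_res[OF z] d1.Q_def)
  also have "\<dots> \<le> (Re (d1.Q v v) + Re (d1.Q y y)) / 2"
    by (rule d1.Re_Q_le)
  also have "Re (d1.Q y y) = (norm y)\<^sup>2 - (norm (T1 y))\<^sup>2"
    by (simp add: d1_Q Re_cinner_self)
  finally have "(norm (T2 y))\<^sup>2 - (norm (T2 (T1 y)))\<^sup>2 \<le> Re (d1.Q v v)"
    using Re_pencil[OF z, of y] by simp
  then show ?thesis by (simp add: Phi_def y_def[symmetric] d1_Q Re_cinner_self commute)
qed

text \<open>Since \<open>G - K T\<^sub>1 = 1 - T\<^sub>1\<^sup>* T\<^sub>1\<close>, the transform of \<open>g\<close> solves the equation of the pencil up to the analytic
  term \<open>z K g\<close>: multiplication by \<open>Phi\<close> represents \<open>T\<^sub>2\<close>.\<close>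

lemma Phi_hat:
  assumes z: "norm z = 1"
  shows "Phi z (full.hat (cnj z) g) = full.hat (cnj z) (T2 g) + z *\<^sub>C T2 (pencil.res z (K g))"
proof -
  have z1: "norm z \<le> 1" "norm (cnj z) \<le> 1" and zz: "z * cnj z = 1"
    using z by (simp_all add: complex_norm_square[symmetric])
  define u where "u = full.hat (cnj z) g"
  have u: "z *\<^sub>C u = T1 u + z *\<^sub>C g"
    using arg_cong[OF full.hat_eq[OF z1(2), of g], of "\<lambda>x. z *\<^sub>C x"]
    by (simp add: u_def scaleC_distribs zz algebra_simps)
  have "z *\<^sub>C K u = K (T1 u) + z *\<^sub>C K g"
    by (metis u clin_add[OF pencil.clin_K] clin_scaleC[OF pencil.clin_K])
  then have "G u - z *\<^sub>C K u = u - adj T1 (T1 u) - z *\<^sub>C K g"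
    by (simp add: G_def K_def clin_diff[OF clin_adj[OF clin_T1]])
  then have "u - adj T1 (T1 u) = (G u - z *\<^sub>C K u) + z *\<^sub>C K g" by simp
  then have "pencil.res z (u - adj T1 (T1 u)) = u + z *\<^sub>C pencil.res z (K g)"
    by (simp only: clin_add[OF pencil.clin_res[OF z1(1)]] clin_scaleC[OF pencil.clin_res[OF z1(1)]]
        pencil.res_pencil[OF z1(1)])
  then have "Phi z u = T2 u + z *\<^sub>C T2 (pencil.res z (K g))"
    by (simp add: Phi_def clin_add[OF clin_T2] clin_scaleC[OF clin_T2])
  moreover have "full.hat (cnj z) (T2 g) = T2 u"
    unfolding u_def by (rule full.hat_commute[OF clin_T2 _ z1(2)]) (simp add: commute)
  ultimately show ?thesis by (simp add: u_def)
qed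

lemma lift_Phi:
  assumes "full.analytic_lift Y g"
  shows "full.analytic_lift (\<lambda>z. Phi z (Y z)) (T2 g)"
proof -
  obtain F where F: "disc_holomorphic F" "\<And>z. norm z = 1 \<Longrightarrow> Y z = full.hat (cnj z) g + z *\<^sub>C F z"
    using assms unfolding full.analytic_lift_def by blast
  have "Phi z (Y z) = full.hat (cnj z) (T2 g) + z *\<^sub>C (T2 (pencil.res z (K g)) + Phi z (F z))"
    if z: "norm z = 1" for z
    using z by (simp add: F(2) clin_add[OF clin_Phi] clin_scaleC[OF clin_Phi] Phi_hat scaleC_add_right add.assoc)
  moreover have "disc_holomorphic (\<lambda>z. T2 (pencil.res z (K g)) + Phi z (F z))"
    unfolding Phi_def
    by (intro disc_holomorphic_add disc_holomorphic_clin[OF clin_T2] pencil.disc_holomorphic_res disc_holomorphic_const disc_holomorphic_clin[OF d1.clin_D F(1)])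
  ultimately show ?thesis unfolding full.analytic_lift_def by blast
qed

lemma lift_Phi_power:
  "full.analytic_lift Y g \<Longrightarrow> full.analytic_lift (\<lambda>z. (Phi z ^^ n) (Y z)) ((T2 ^^ n) g)"
  by (induction n) (simp_all add: lift_Phi)

text \<open>At a fixed point of the circle \<open>p(z, w)\<close> is a polynomial in \<open>w\<close> alone, so von Neumann's inequality
  for the contraction \<open>Phi z\<close> gives the bound that the boundary estimate asks for.\<close>

lemma strict_ando:
  assumes I: "finite I"
    and s: "\<And>z w. norm z = 1 \<Longrightarrow> norm w = 1 \<Longrightarrow> norm (\<Sum>i\<in>I. d i * (z ^ e i * w ^ e' i)) \<le> s"
  shows "Re (cinner (\<Sum>i\<in>I. d i *\<^sub>C (T1 ^^ e i) ((T2 ^^ e' i) h)) k) \<le> s / 2 * ((norm h)\<^sup>2 + (norm k)\<^sup>2)"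
proof -
  have "Re (full.Q (\<Sum>i\<in>I. d i *\<^sub>C (T1 ^^ e i) ((T2 ^^ e' i) h)) k)
      \<le> s / 2 * (Re (full.Q h h) + Re (full.Q k k))"
  proof (rule full.boundary_estimate)
    show "full.analytic_lift (\<lambda>z. \<Sum>i\<in>I. d i *\<^sub>C (z ^ e i *\<^sub>C (Phi z ^^ e' i) (full.hat (cnj z) h)))
        (\<Sum>i\<in>I. d i *\<^sub>C (T1 ^^ e i) ((T2 ^^ e' i) h))"
      by (intro full.lift_sum I full.lift_scale full.lift_shift_power lift_Phi_power full.lift_hat)
    fix z :: complex assume z: "norm z = 1"
    have "Re (d1.Q (\<Sum>i\<in>I. (d i * z ^ e i) *\<^sub>C (Phi z ^^ e' i) u) v)
        \<le> s / 2 * (Re (d1.Q u u) + Re (d1.Q v v))" for u v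
      by (rule d1.von_neumann[OF clin_Phi Phi_contraction I])
        (use z s[OF z] in \<open>simp_all add: mult.assoc\<close>)
    then show "Re (full.E (\<Sum>i\<in>I. d i *\<^sub>C (z ^ e i *\<^sub>C (Phi z ^^ e' i) (full.hat (cnj z) h))) (full.hat (cnj z) k))
      \<le> s / 2 * (Re (full.E (full.hat (cnj z) h) (full.hat (cnj z) h))
          + Re (full.E (full.hat (cnj z) k) (full.hat (cnj z) k)))"
      by (simp add: full_E scaleC_scaleC)
  qed
  then show ?thesis by (simp add: full.Q_def Re_cinner_self)
qed

end

text \<open>The additive bound, tested on the multiple of \<open>g\<close> that has the norm of \<open>h\<close>, gives the operator
  bound.\<close>

lemma norm_le_of_Re_cinner_le:
  fixes g h :: "'a::complex_hilbert"
  assumes le: "\<And>k. Re (cinner g k) \<le> s / 2 * ((norm h)\<^sup>2 + (norm k)\<^sup>2)" and h: "h = 0 \<Longrightarrow> g = 0"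
    and s: "0 \<le> s"
  shows "norm g \<le> s * norm h"
proof (cases "g = 0")
  case False
  then have pos: "norm g > 0" "norm h > 0" using h by auto
  define t where "t = norm h / norm g"
  have "\<bar>t\<bar> = t" using pos by (simp add: t_def)
  then have "t * (norm g)\<^sup>2 \<le> s / 2 * ((norm h)\<^sup>2 + (t * norm g)\<^sup>2)"
    using le[of "complex_of_real t *\<^sub>C g"]
    by (simp add: cinner_scaleC_right norm_scaleC Re_cinner_self)
  then have "norm g * norm h \<le> (s * norm h) * norm h"
    using pos by (simp add: t_def power2_eq_square)
  then show ?thesis using pos by simp
qed (use s in simp)

text \<open>The pair is scaled into the open unit ball by \<open>t < 1\<close>, and \<open>t\<close> tends to \<open>1\<close>.\<close>

theorem ando_inequality:
  fixes T1 T2 :: "'a::complex_hilbert \<Rightarrow> 'a"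
  assumes T: "clin T1" "clin T2" and comm: "\<And>x. T1 (T2 x) = T2 (T1 x)"
    and contr: "\<And>x. norm (T1 x) \<le> norm x" "\<And>x. norm (T2 x) \<le> norm x"
    and I: "finite I"
    and s: "\<And>z w. norm z = 1 \<Longrightarrow> norm w = 1 \<Longrightarrow> norm (\<Sum>i\<in>I. d i * (z ^ e i * w ^ e' i)) \<le> s"
  shows "norm (\<Sum>i\<in>I. d i *\<^sub>C (T1 ^^ e i) ((T2 ^^ e' i) h)) \<le> s * norm h"
proof -
  have s0: "0 \<le> s" using s[of 1 1] by (rule order_trans[rotated]) auto
  have strict: "norm (\<Sum>i\<in>I. d i *\<^sub>C (complex_of_real t ^ e i * complex_of_real t ^ e' i) *\<^sub>C (T1 ^^ e i) ((T2 ^^ e' i) h)) \<le> s * norm h"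
    if t: "0 < t" "t < 1" for t
  proof -
    interpret strict_commuting_pair "\<lambda>x. complex_of_real t *\<^sub>C T1 x" "\<lambda>x. complex_of_real t *\<^sub>C T2 x" t
      by unfold_locales
        (use t contr in \<open>simp_all add: clin_scale T clin_scaleC[OF T(1)] clin_scaleC[OF T(2)] comm norm_scaleC\<close>)
    have eq: "((\<lambda>x. complex_of_real t *\<^sub>C T1 x) ^^ m) (((\<lambda>x. complex_of_real t *\<^sub>C T2 x) ^^ n) x)
       = (complex_of_real t ^ m * complex_of_real t ^ n) *\<^sub>C (T1 ^^ m) ((T2 ^^ n) x)" for m n x
      by (simp add: clin_scaled_power T clin_scaleC[OF clin_power[OF T(1)]] scaleC_scaleC)
    show ?thesis
      by (rule norm_le_of_Re_cinner_le[OF strict_ando[OF I s, where h = h, unfolded eq]])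
        (simp_all add: s0 clin_zero clin_power T)
  qed
  have "((\<lambda>t. norm (\<Sum>i\<in>I. d i *\<^sub>C (complex_of_real t ^ e i * complex_of_real t ^ e' i) *\<^sub>C (T1 ^^ e i) ((T2 ^^ e' i) h)))
      \<longlongrightarrow> norm (\<Sum>i\<in>I. d i *\<^sub>C (complex_of_real 1 ^ e i * complex_of_real 1 ^ e' i) *\<^sub>C (T1 ^^ e i) ((T2 ^^ e' i) h))) (at_left 1)"
    by (intro tendsto_intros tendsto_scaleC)
  then have "norm (\<Sum>i\<in>I. d i *\<^sub>C (complex_of_real 1 ^ e i * complex_of_real 1 ^ e' i) *\<^sub>C (T1 ^^ e i) ((T2 ^^ e' i) h)) \<le> s * norm h"
  proof (rule tendsto_upperbound)
    show "\<forall>\<^sub>F t in at_left 1. norm (\<Sum>i\<in>I. d i *\<^sub>C (complex_of_real t ^ e i * complex_of_real t ^ e' i) *\<^sub>C (T1 ^^ e i) ((T2 ^^ e' i) h))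
        \<le> s * norm h"
      using eventually_at_left_real[of 0 1, OF zero_less_one]
      by (rule eventually_mono) (rule strict, auto)
  qed simp
  then show ?thesis by simp
qed


section \<open>Polynomials under linear changes of variables\<close>

lemma blinfun_apply_scaleC: "blinfun_apply (c *\<^sub>C T) x = c *\<^sub>C blinfun_apply T x"
  for T :: "'a::real_normed_vector \<Rightarrow>\<^sub>L 'b::complex_hilbert"
  by transfer simp

lemma poly_at_superset:
  assumes "finite A" "Poly_Mapping.keys p \<subseteq> A"
  shows "poly_at p z = (\<Sum>m\<in>A. Poly_Mapping.lookup p m * (\<Prod>i\<in>UNIV. (z $ i) ^ Poly_Mapping.lookup m i))"
  unfolding poly_at_def using assms by (intro sum.mono_neutral_left) (auto simp: in_keys_iff)

lemma poly_op_superset: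
  assumes "finite A" "Poly_Mapping.keys p \<subseteq> A"
  shows "poly_op p T = (\<Sum>m\<in>A. Poly_Mapping.lookup p m *\<^sub>C monom_op m T)"
  unfolding poly_op_def using assms
  by (intro sum.mono_neutral_left) (auto simp: in_keys_iff intro!: blinfun_eqI simp: blinfun_apply_scaleC)

lemma poly_at_add: "poly_at (p + q) z = poly_at p z + poly_at q z"
proof -
  let ?A = "Poly_Mapping.keys p \<union> Poly_Mapping.keys q"
  have "Poly_Mapping.keys (p + q) \<subseteq> ?A" by (rule Poly_Mapping.keys_add)
  then show ?thesis
    by (simp add: poly_at_superset[where A = ?A] lookup_add algebra_simps sum.distrib)
qed

lemma poly_op_add: "poly_op (p + q) T = poly_op p T + poly_op q T"
proof -
  let ?A = "Poly_Mapping.keys p \<union> Poly_Mapping.keys q"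
  have "Poly_Mapping.keys (p + q) \<subseteq> ?A" by (rule Poly_Mapping.keys_add)
  then have "poly_op (p + q) T = (\<Sum>m\<in>?A. Poly_Mapping.lookup (p + q) m *\<^sub>C monom_op m T)"
    by (intro poly_op_superset) auto
  also have "\<dots> = (\<Sum>m\<in>?A. Poly_Mapping.lookup p m *\<^sub>C monom_op m T) + (\<Sum>m\<in>?A. Poly_Mapping.lookup q m *\<^sub>C monom_op m T)"
    unfolding sum.distrib[symmetric]
    by (intro sum.cong refl blinfun_eqI) (simp add: lookup_add blinfun_apply_scaleC blinfun.add_left scaleC_add_left)
  finally show ?thesis by (simp add: poly_op_superset[where A = ?A])
qed

lemma poly_at_single:
  "poly_at (Poly_Mapping.single m c) z = c * (\<Prod>i\<in>UNIV. (z $ i) ^ Poly_Mapping.lookup m i)"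
  by (simp add: poly_at_superset[where A = "{m}"])

lemma poly_op_single: "poly_op (Poly_Mapping.single m c) T = c *\<^sub>C monom_op m T"
  by (simp add: poly_op_superset[where A = "{m}"])

lemma poly_at_zero: "poly_at 0 z = 0"
  by (simp add: poly_at_def)

lemma poly_op_zero: "poly_op 0 T = 0"
  by (simp add: poly_op_def)

lemma poly_at_sum: "poly_at (\<Sum>i\<in>I. p i) z = (\<Sum>i\<in>I. poly_at (p i) z)"
  by (induction I rule: infinite_finite_induct) (simp_all add: poly_at_zero poly_at_add)

lemma poly_op_sum: "poly_op (\<Sum>i\<in>I. p i) T = (\<Sum>i\<in>I. poly_op (p i) T)"
  by (induction I rule: infinite_finite_induct) (simp_all add: poly_op_zero poly_op_add)

lemma compose_power_apply: "blinfun_apply (((\<lambda>R. A o\<^sub>L R) ^^ n) R) x = (blinfun_apply A ^^ n) (blinfun_apply R x)"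
  for A :: "'a::real_normed_vector \<Rightarrow>\<^sub>L 'a"
  by (induction n) simp_all

lemma monom_op_apply:
  "blinfun_apply (monom_op m T) x =
    foldr (\<lambda>i. blinfun_apply (T $ i) ^^ Poly_Mapping.lookup m i) (sorted_list_of_set UNIV) x"
proof -
  have "blinfun_apply (foldr (\<lambda>i R. (((o\<^sub>L) (T $ i)) ^^ Poly_Mapping.lookup m i) R) xs id_blinfun) x
      = foldr (\<lambda>i. blinfun_apply (T $ i) ^^ Poly_Mapping.lookup m i) xs x" for xs
    by (induction xs) (simp_all add: compose_power_apply)
  then show ?thesis by (simp add: monom_op_def)
qed

lemma funpow_commute_elem:
  assumes "\<And>x. f (g x) = g (f x)"
  shows "f ((g ^^ n) x) = (g ^^ n) (f x)"
  by (induction n) (simp_all add: assms)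

lemma foldr_funpow_Suc:
  assumes "\<And>i j x. f i (f j x) = f j (f i x)" "distinct xs" "j \<in> set xs"
    "k' j = Suc (k j)" "\<And>i. i \<noteq> j \<Longrightarrow> k' i = k i"
  shows "foldr (\<lambda>i. f i ^^ k' i) xs x = f j (foldr (\<lambda>i. f i ^^ k i) xs x)"
  using assms(2,3)
proof (induction xs)
  case (Cons a xs)
  show ?case
  proof (cases "a = j")
    case True
    then have "i \<noteq> j" if "i \<in> set xs" for i using Cons.prems(1) that by auto
    then have "foldr (\<lambda>i. f i ^^ k' i) xs x = foldr (\<lambda>i. f i ^^ k i) xs x"
      by (intro foldr_cong) (simp_all add: assms(5))
    then show ?thesis using True by (simp add: assms(4))
  next
    case False
    then show ?thesis using Cons
      by (simp add: assms(5) funpow_commute_elem[of "f j" "f a", OF assms(1)])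
  qed
qed simp

lemma commuting_tuple_apply:
  assumes "commuting_tuple T"
  shows "blinfun_apply (T $ i) (blinfun_apply (T $ k) y) = blinfun_apply (T $ k) (blinfun_apply (T $ i) y)"
proof -
  have "T $ i o\<^sub>L T $ k = T $ k o\<^sub>L T $ i" using assms unfolding commuting_tuple_def by blast
  from arg_cong[OF this, of "\<lambda>R. blinfun_apply R y"] show ?thesis by simp
qed

lemma monom_op_times_var:
  assumes "commuting_tuple T"
  shows "monom_op (m + Poly_Mapping.single j 1) T = T $ j o\<^sub>L monom_op m T"
proof (rule blinfun_eqI)
  fix x
  show "blinfun_apply (monom_op (m + Poly_Mapping.single j 1) T) x = blinfun_apply (T $ j o\<^sub>L monom_op m T) x"
    unfolding monom_op_apply blinfun_apply_blinfun_compose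
    by (rule foldr_funpow_Suc[where f = "\<lambda>i. blinfun_apply (T $ i)", OF commuting_tuple_apply[OF assms]]) (auto simp: lookup_add lookup_single)
qed

lemma monom_op_zero: "monom_op 0 T = id_blinfun"
proof -
  have "foldr (\<lambda>i R. R) xs y = y" for xs :: "'n list" and y :: "'a \<Rightarrow>\<^sub>L 'a"
    by (induction xs) simp_all
  then show ?thesis by (simp add: monom_op_def)
qed

text \<open>The function and the operator are the values of one and the same polynomial. Working with this
  relation avoids constructing the polynomials that arise from a substitution.\<close>

definition poly_pair ::
    "('a::complex_hilbert \<Rightarrow>\<^sub>L 'a) ^ 'n::{finite,linorder} \<Rightarrow> (complex ^ 'n::{finite,linorder} \<Rightarrow> complex) \<Rightarrow> ('a \<Rightarrow>\<^sub>L 'a) \<Rightarrow> bool"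
  where "poly_pair T \<phi> R \<longleftrightarrow> (\<exists>q. (\<forall>z. poly_at q z = \<phi> z) \<and> poly_op q T = R)"

lemma poly_pair_one: "poly_pair T (\<lambda>z. 1) id_blinfun"
  unfolding poly_pair_def
  using poly_at_single[of 0 1] poly_op_single[of 0 1 T]
  by (intro exI[of _ 1]) (auto simp: monom_op_zero blinfun_apply_scaleC intro!: blinfun_eqI)

lemma poly_pair_zero: "poly_pair T (\<lambda>z. 0) 0"
  unfolding poly_pair_def by (rule exI[of _ 0]) (simp add: poly_at_zero poly_op_zero)

lemma poly_pair_add:
  "poly_pair T \<phi> R \<Longrightarrow> poly_pair T \<psi> S \<Longrightarrow> poly_pair T (\<lambda>z. \<phi> z + \<psi> z) (R + S)"
  unfolding poly_pair_def by (metis poly_at_add poly_op_add)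

lemma poly_pair_sum:
  assumes "\<And>i. i \<in> I \<Longrightarrow> poly_pair T (\<phi> i) (R i)"
  shows "poly_pair T (\<lambda>z. \<Sum>i\<in>I. \<phi> i z) (\<Sum>i\<in>I. R i)"
  using assms by (induction I rule: infinite_finite_induct) (auto simp: poly_pair_zero intro: poly_pair_add)

lemma poly_pair_scale:
  assumes "poly_pair T \<phi> R"
  shows "poly_pair T (\<lambda>z. c * \<phi> z) (c *\<^sub>C R)"
proof -
  obtain q where q: "\<And>z. poly_at q z = \<phi> z" "poly_op q T = R"
    using assms unfolding poly_pair_def by blast
  define q' where "q' = (\<Sum>m\<in>Poly_Mapping.keys q. Poly_Mapping.single m (c * Poly_Mapping.lookup q m))"
  have "poly_at q' z = c * \<phi> z" for z
    unfolding q'_def poly_at_sum poly_at_single unfolding q(1)[symmetric] poly_at_def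
    by (simp add: sum_distrib_left mult.assoc)
  moreover have "poly_op q' T = c *\<^sub>C R"
    unfolding q'_def poly_op_sum poly_op_single unfolding q(2)[symmetric] poly_op_def
    by (rule blinfun_eqI) (simp add: blinfun.sum_left blinfun_apply_scaleC scaleC_sum_right scaleC_scaleC)
  ultimately show ?thesis unfolding poly_pair_def by blast
qed

lemma prod_times_var:
  "(\<Prod>i\<in>UNIV. (z $ i) ^ Poly_Mapping.lookup (m + Poly_Mapping.single j 1) i)
    = z $ j * (\<Prod>i\<in>UNIV. (z $ i) ^ Poly_Mapping.lookup m i)" for z :: "complex ^ 'n::finite"
proof -
  have "(\<Prod>i\<in>UNIV. (z $ i) ^ Poly_Mapping.lookup (m + Poly_Mapping.single j 1) i)
      = (\<Prod>i\<in>UNIV. (z $ i) ^ Poly_Mapping.lookup m i * (if i = j then z $ j else 1))"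
    by (intro prod.cong refl) (simp add: lookup_add lookup_single when_def)
  then show ?thesis by (simp add: prod.distrib mult.commute)
qed

lemma poly_pair_var:
  assumes T: "commuting_tuple T" "\<And>i. complex_linear (T $ i)" and pair: "poly_pair T \<phi> R"
  shows "poly_pair T (\<lambda>z. z $ j * \<phi> z) (T $ j o\<^sub>L R)"
proof -
  obtain q where q: "\<And>z. poly_at q z = \<phi> z" "poly_op q T = R"
    using pair unfolding poly_pair_def by blast
  define q' where "q' = (\<Sum>m\<in>Poly_Mapping.keys q.
    Poly_Mapping.single (m + Poly_Mapping.single j 1) (Poly_Mapping.lookup q m))"
  have "poly_at q' z = z $ j * \<phi> z" for z
    unfolding q'_def poly_at_sum poly_at_single prod_times_var unfolding q(1)[symmetric] poly_at_def
    by (simp add: sum_distrib_left mult.left_commute)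
  moreover have "poly_op q' T = T $ j o\<^sub>L R"
    using T(2)[of j] unfolding complex_linear_def
    unfolding q'_def poly_op_sum poly_op_single unfolding q(2)[symmetric] poly_op_def
    by (intro blinfun_eqI) (simp add: monom_op_times_var[OF T(1), simplified] blinfun.sum_left blinfun.sum_right blinfun_apply_scaleC)
  ultimately show ?thesis unfolding poly_pair_def by blast
qed

definition linear_image ::
    "complex ^ 'm ^ 'n \<Rightarrow> ('a::complex_hilbert \<Rightarrow>\<^sub>L 'a) ^ 'm::finite \<Rightarrow> ('a \<Rightarrow>\<^sub>L 'a) ^ 'n"
  where "linear_image L T = (\<chi> i. \<Sum>j\<in>UNIV. L $ i $ j *\<^sub>C T $ j)"

context
  fixes T :: "('a::complex_hilbert \<Rightarrow>\<^sub>L 'a) ^ 'm::{finite,linorder}"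
    and L :: "complex ^ 'm::{finite,linorder} ^ 'n::{finite,linorder}"
  assumes comm: "commuting_tuple T" and lin: "\<And>i. complex_linear (T $ i)"
begin

lemma poly_pair_linear:
  assumes pair: "poly_pair T \<phi> R"
  shows "poly_pair T (\<lambda>z. (L *v z) $ i * \<phi> z) (linear_image L T $ i o\<^sub>L R)"
proof -
  have "poly_pair T (\<lambda>z. \<Sum>j\<in>UNIV. L $ i $ j * (z $ j * \<phi> z)) (\<Sum>j\<in>UNIV. L $ i $ j *\<^sub>C (T $ j o\<^sub>L R))"
    by (intro poly_pair_sum poly_pair_scale poly_pair_var comm lin pair)
  moreover have "(\<Sum>j\<in>UNIV. L $ i $ j *\<^sub>C (T $ j o\<^sub>L R)) = linear_image L T $ i o\<^sub>L R"
    by (rule blinfun_eqI) (simp add: linear_image_def blinfun.sum_left blinfun_apply_scaleC)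
  moreover have "(\<Sum>j\<in>UNIV. L $ i $ j * (z $ j * \<phi> z)) = (L *v z) $ i * \<phi> z" for z
    by (simp add: matrix_vector_mult_def sum_distrib_right mult.assoc)
  ultimately show ?thesis by simp
qed

lemma poly_pair_linear_power:
  assumes pair: "poly_pair T \<phi> R"
  shows "poly_pair T (\<lambda>z. (L *v z) $ i ^ n * \<phi> z) (((o\<^sub>L) (linear_image L T $ i) ^^ n) R)"
proof (induction n)
  case (Suc n)
  then show ?case using poly_pair_linear[OF Suc.IH, of i] by (simp add: mult.assoc)
qed (simp add: pair)

lemma poly_pair_linear_monom:
  "poly_pair T (\<lambda>z. \<Prod>i\<in>UNIV. (L *v z) $ i ^ Poly_Mapping.lookup m i) (monom_op m (linear_image L T))"
proof -
  have "distinct xs \<Longrightarrow> poly_pair T (\<lambda>z. \<Prod>i\<in>set xs. (L *v z) $ i ^ Poly_Mapping.lookup m i)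
      (foldr (\<lambda>i R. ((o\<^sub>L) (linear_image L T $ i) ^^ Poly_Mapping.lookup m i) R) xs id_blinfun)" for xs
    by (induction xs) (auto simp: poly_pair_one intro!: poly_pair_linear_power)
  from this[of "sorted_list_of_set UNIV"] show ?thesis by (simp add: monom_op_def)
qed

lemma poly_pair_linear_poly: "poly_pair T (\<lambda>z. poly_at p (L *v z)) (poly_op p (linear_image L T))"
  unfolding poly_at_def poly_op_def
  by (intro poly_pair_sum poly_pair_scale poly_pair_linear_monom)

lemma linear_image_complex_linear: "complex_linear (linear_image L T $ i)"
  using lin unfolding complex_linear_def
  by (simp add: linear_image_def blinfun.sum_left blinfun_apply_scaleC scaleC_sum_right scaleC_scaleC mult.commute)

lemma linear_image_commuting: "commuting_tuple (linear_image L T)"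
  unfolding commuting_tuple_def
proof (intro allI blinfun_eqI)
  fix i j x
  note c = commuting_tuple_apply[OF comm]
  have lin': "blinfun_apply (T $ k) (a *\<^sub>C y) = a *\<^sub>C blinfun_apply (T $ k) y" for k a y
    using lin unfolding complex_linear_def by simp
  have "blinfun_apply (linear_image L T $ i o\<^sub>L linear_image L T $ j) x
      = (\<Sum>k\<in>UNIV. \<Sum>l\<in>UNIV. (L $ i $ k * L $ j $ l) *\<^sub>C blinfun_apply (T $ k) (blinfun_apply (T $ l) x))"
    by (simp add: linear_image_def blinfun.sum_left blinfun.sum_right blinfun_apply_scaleC
        scaleC_sum_right scaleC_scaleC lin') (rule sum.swap)
  also have "\<dots> = (\<Sum>l\<in>UNIV. \<Sum>k\<in>UNIV. (L $ j $ l * L $ i $ k) *\<^sub>C blinfun_apply (T $ l) (blinfun_apply (T $ k) x))"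
    by (subst sum.swap) (intro sum.cong refl arg_cong2[where f = scaleC] c mult.commute)
  also have "\<dots> = blinfun_apply (linear_image L T $ j o\<^sub>L linear_image L T $ i) x"
    by (simp add: linear_image_def blinfun.sum_left blinfun.sum_right blinfun_apply_scaleC
        scaleC_sum_right scaleC_scaleC lin') (rule sum.swap)
  finally show "blinfun_apply (linear_image L T $ i o\<^sub>L linear_image L T $ j) x
      = blinfun_apply (linear_image L T $ j o\<^sub>L linear_image L T $ i) x" .
qed

end

lemma continuous_on_poly_at: "continuous_on S (poly_at p)"
  unfolding poly_at_def[abs_def] by (intro continuous_intros)

lemma bdd_above_poly_at:
  assumes "bounded \<Omega>"
  shows "bdd_above ((\<lambda>z. cmod (poly_at p z)) ` closure \<Omega>)"
  by (intro bounded_imp_bdd_above compact_imp_bounded compact_continuous_image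
      continuous_on_norm continuous_on_poly_at) (simp add: assms compact_closure)

text \<open>The value of the polynomial \<open>p \<circ> L\<close> at \<open>T\<close> is that of \<open>p\<close> at \<open>L T\<close>, and \<open>L\<close> maps the closure of \<open>\<Omega>\<close> into that
  of \<open>\<Omega>'\<close>. Boundedness of \<open>\<Omega>'\<close> makes the supremum over its closure an upper bound, and nonemptiness
  of \<open>\<Omega>\<close> makes the supremum over its closure a least upper bound.\<close>

lemma domain_contraction_linear_image:
  fixes L :: "complex ^ 'm::{finite,linorder} ^ 'n::{finite,linorder}"
  assumes T: "domain_contraction \<Omega> T" and ne: "\<Omega> \<noteq> {}" and bd: "bounded \<Omega>'"
    and maps: "\<And>z. z \<in> \<Omega> \<Longrightarrow> L *v z \<in> \<Omega>'"
  shows "domain_contraction \<Omega>' (linear_image L T)"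
proof -
  have T': "commuting_tuple T" "\<And>i. complex_linear (T $ i)"
    using T unfolding domain_contraction_def by auto
  have "(\<lambda>z. L *v z) ` closure \<Omega> \<subseteq> closure \<Omega>'"
  proof (rule image_closure_subset)
    show "continuous_on (closure \<Omega>) (\<lambda>z. L *v z)"
      unfolding matrix_vector_mult_def by (intro continuous_intros)
    show "(\<lambda>z. L *v z) ` \<Omega> \<subseteq> closure \<Omega>'"
      using maps closure_subset by blast
  qed simp
  then have cl: "L *v z \<in> closure \<Omega>'" if "z \<in> closure \<Omega>" for z using that by blast
  have "norm (poly_op p (linear_image L T)) \<le> (SUP z\<in>closure \<Omega>'. cmod (poly_at p z))" for p
  proof -
    obtain q where q: "\<And>z. poly_at q z = poly_at p (L *v z)" "poly_op q T = poly_op p (linear_image L T)"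
      using poly_pair_linear_poly[OF T'] unfolding poly_pair_def by metis
    have "norm (poly_op q T) \<le> (SUP z\<in>closure \<Omega>. cmod (poly_at q z))"
      using T unfolding domain_contraction_def by blast
    also have "\<dots> \<le> (SUP z\<in>closure \<Omega>'. cmod (poly_at p z))"
    proof (rule cSUP_least)
      show "closure \<Omega> \<noteq> {}" using ne by simp
      fix z assume "z \<in> closure \<Omega>"
      then show "cmod (poly_at q z) \<le> (SUP z\<in>closure \<Omega>'. cmod (poly_at p z))"
        unfolding q(1) by (intro cSUP_upper cl bdd_above_poly_at bd)
    qed
    finally show ?thesis by (simp add: q(2))
  qed
  then show ?thesis unfolding domain_contraction_def
    using linear_image_complex_linear[OF T'] linear_image_commuting[OF T'] by blast
qed


section \<open>Ando's inequality as a statement about the bidisc\<close>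

definition bidisc :: "(complex ^ 2) set"
  where "bidisc = {z. cmod (z $ 1) < 1 \<and> cmod (z $ 2) < 1}"

lemma bounded_coordinates:
  fixes \<Omega> :: "(complex ^ 'n) set"
  assumes "\<And>z i. z \<in> \<Omega> \<Longrightarrow> cmod (z $ i) \<le> B"
  shows "bounded \<Omega>"
proof (rule boundedI)
  fix z assume "z \<in> \<Omega>"
  then have "(\<Sum>i\<in>UNIV. cmod (z $ i)) \<le> (\<Sum>i\<in>(UNIV :: 'n set). B)"
    by (intro sum_mono assms)
  then show "norm z \<le> (\<Sum>i\<in>(UNIV :: 'n set). B)"
    unfolding norm_vec_def using L2_set_le_sum[of UNIV "\<lambda>i. norm (z $ i)"] by simp
qed

lemma bounded_bidisc: "bounded bidisc"
proof (rule bounded_coordinates)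
  show "cmod (z $ i) \<le> 1" if "z \<in> bidisc" for z and i :: 2
    using that exhaust_2[of i] by (auto simp: bidisc_def)
qed

text \<open>Ando's inequality is proved with the supremum over the torus, while the supremum in question is over
  the closed bidisc.\<close>

lemma torus_in_closure_bidisc:
  assumes "norm z = 1" "norm w = 1"
  shows "vector [z, w] \<in> closure bidisc"
proof (rule Lim_in_closed_set)
  show "((\<lambda>t. vector [complex_of_real t * z, complex_of_real t * w]) \<longlongrightarrow> (vector [z, w] :: complex ^ 2)) (at_left 1)"
  proof (rule vec_tendstoI)
    fix i :: 2
    have "((\<lambda>t. complex_of_real t * z) \<longlongrightarrow> complex_of_real 1 * z) (at_left 1)"
      "((\<lambda>t. complex_of_real t * w) \<longlongrightarrow> complex_of_real 1 * w) (at_left 1)"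
      by (intro tendsto_intros)+
    then show "((\<lambda>t. (vector [complex_of_real t * z, complex_of_real t * w] :: complex ^ 2) $ i) \<longlongrightarrow> (vector [z, w] :: complex ^ 2) $ i) (at_left 1)"
      using exhaust_2[of i] by auto
  qed
  show "\<forall>\<^sub>F t in at_left 1. vector [complex_of_real t * z, complex_of_real t * w] \<in> closure bidisc"
    using eventually_at_left_real[of 0 1, OF zero_less_one]
    by (rule eventually_mono, intro closure_subset[THEN subsetD]) (simp add: bidisc_def norm_mult assms)
qed simp_all

lemma funpow_commute:
  assumes "\<And>x. f (g x) = g (f x)"
  shows "(f ^^ m) ((g ^^ n) x) = (g ^^ n) ((f ^^ m) x)"
  by (induction m) (simp_all add: funpow_commute_elem[of f g, OF assms])

text \<open>The order of the factors in a monomial is that of the index type \<open>2\<close>, in which the index written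
  \<open>2\<close> is the zero element; commutativity makes this irrelevant.\<close>

lemma poly_op_pair:
  assumes comm: "A o\<^sub>L X = X o\<^sub>L A"
  shows "blinfun_apply (poly_op p (vector [A, X] :: _ ^ 2)) x
    = (\<Sum>m\<in>Poly_Mapping.keys p. Poly_Mapping.lookup p m *\<^sub>C
        (blinfun_apply A ^^ Poly_Mapping.lookup m 1) ((blinfun_apply X ^^ Poly_Mapping.lookup m 2) x))"
proof -
  let ?xs = "sorted_list_of_set (UNIV :: 2 set)"
  have c: "blinfun_apply A (blinfun_apply X y) = blinfun_apply X (blinfun_apply A y)" for y
    using arg_cong[OF comm, of "\<lambda>R. blinfun_apply R y"] by simp
  have "length ?xs = 2" by simp
  then obtain i j where xs: "?xs = [i, j]" by (metis length_0_conv length_Suc_conv numeral_2_eq_2)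
  moreover have "distinct ?xs" by simp
  ultimately have "i \<noteq> j" by (metis distinct_length_2_or_more)
  then have "i = 1 \<and> j = 2 \<or> i = 2 \<and> j = 1" using exhaust_2[of i] exhaust_2[of j] by auto
  then have "blinfun_apply (monom_op m (vector [A, X] :: _ ^ 2)) x
      = (blinfun_apply A ^^ Poly_Mapping.lookup m 1) ((blinfun_apply X ^^ Poly_Mapping.lookup m 2) x)" for m
    unfolding monom_op_apply xs
    by (auto simp: funpow_commute[of "blinfun_apply A" "blinfun_apply X", OF c])
  then show ?thesis by (simp add: poly_op_def blinfun.sum_left blinfun_apply_scaleC)
qed

lemma commuting_tuple_pair: "A o\<^sub>L X = X o\<^sub>L A \<Longrightarrow> commuting_tuple (vector [A, X] :: _ ^ 2)"
  by (simp add: commuting_tuple_def forall_2)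

lemma ando_bidisc:
  fixes A X :: "'a::complex_hilbert \<Rightarrow>\<^sub>L 'a"
  assumes lin: "complex_linear A" "complex_linear X" and comm: "A o\<^sub>L X = X o\<^sub>L A"
    and contr: "norm A \<le> 1" "norm X \<le> 1"
  shows "domain_contraction bidisc (vector [A, X])"
proof -
  have "norm (poly_op p (vector [A, X])) \<le> (SUP z\<in>closure bidisc. cmod (poly_at p z))" (is "_ \<le> ?s") for p
  proof (rule norm_blinfun_bound)
    have le: "cmod (poly_at p (vector [z, w])) \<le> ?s" if "norm z = 1" "norm w = 1" for z w
      by (intro cSUP_upper torus_in_closure_bidisc that bdd_above_poly_at bounded_bidisc)
    show "0 \<le> ?s" using le[of 1 1] by (rule order_trans[rotated]) auto
    have le': "norm (\<Sum>m\<in>Poly_Mapping.keys p. Poly_Mapping.lookup p m *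
        (z ^ Poly_Mapping.lookup m 1 * w ^ Poly_Mapping.lookup m 2)) \<le> ?s" if "norm z = 1" "norm w = 1" for z w
      using le[OF that] by (simp add: poly_at_def UNIV_2)
    have bd: "norm (blinfun_apply T y) \<le> norm y" if "norm T \<le> 1" for T :: "'a \<Rightarrow>\<^sub>L 'a" and y
      using norm_blinfun[of T y] mult_right_mono[OF that, of "norm y"] by simp
    have c: "blinfun_apply A (blinfun_apply X y) = blinfun_apply X (blinfun_apply A y)" for y
      using arg_cong[OF comm, of "\<lambda>R. blinfun_apply R y"] by simp
    show "norm (blinfun_apply (poly_op p (vector [A, X])) x) \<le> ?s * norm x" for x
      unfolding poly_op_pair[OF comm]
      by (rule ando_inequality[OF clin_blinfun[OF lin(1)] clin_blinfun[OF lin(2)] c bd[OF contr(1)] bd[OF contr(2)] finite_keys le'])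
  qed
  then show ?thesis unfolding domain_contraction_def
    using lin commuting_tuple_pair[OF comm] by (simp add: forall_2)
qed

lemma bidisc_contraction_norm:
  assumes "domain_contraction bidisc T"
  shows "norm (T $ j) \<le> 1"
proof -
  define p :: "2 cpoly" where "p = Poly_Mapping.single (0 + Poly_Mapping.single j 1) 1"
  have T: "commuting_tuple T" using assms unfolding domain_contraction_def by blast
  have "poly_op p T = T $ j"
    unfolding p_def poly_op_single monom_op_times_var[OF T] monom_op_zero
    by (rule blinfun_eqI) (simp add: blinfun_apply_scaleC)
  moreover have "norm (poly_op p T) \<le> (SUP z\<in>closure bidisc. cmod (poly_at p z))"
    using assms unfolding domain_contraction_def by blast
  moreover have "(SUP z\<in>closure bidisc. cmod (poly_at p z)) \<le> 1"
  proof (rule cSUP_least)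
    have "vector [1, 1] \<in> closure bidisc" by (rule torus_in_closure_bidisc) simp_all
    then show "closure bidisc \<noteq> {}" using empty_iff by metis
    have "closed {z :: complex ^ 2. cmod (z $ j) \<le> 1}"
      by (intro closed_Collect_le continuous_intros)
    moreover have "bidisc \<subseteq> {z. cmod (z $ j) \<le> 1}"
      using exhaust_2[of j] by (auto simp: bidisc_def)
    ultimately have "closure bidisc \<subseteq> {z. cmod (z $ j) \<le> 1}" by (rule closure_minimal[rotated])
    moreover have "poly_at p z = z $ j" for z
      unfolding p_def poly_at_single prod_times_var by simp
    ultimately show "cmod (poly_at p z) \<le> 1" if "z \<in> closure bidisc" for z using that by auto
  qed
  ultimately show ?thesis by simp
qed


section \<open>Membership in the domains\<close>

lemma vector_4 [simp]:
  "(vector [w, x, y, z] :: 'a::zero ^ 4) $ 1 = w" "(vector [w, x, y, z] :: 'a ^ 4) $ 2 = x"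
  "(vector [w, x, y, z] :: 'a ^ 4) $ 3 = y" "(vector [w, x, y, z] :: 'a ^ 4) $ 4 = z"
  unfolding vector_def by simp_all

lemma vector_eta:
  "vector [v $ 1, v $ 2] = v" "vector [u $ 1, u $ 2, u $ 3] = u" "vector [t $ 1, t $ 2, t $ 3, t $ 4] = t"
  for v :: "'a::zero ^ 2" and u :: "'a ^ 3" and t :: "'a ^ 4"
  by (simp_all add: vec_eq_iff forall_2 forall_3 forall_4)

lemma SUP_less_iff_bound:
  fixes f :: "'b \<Rightarrow> real"
  assumes "S \<noteq> {}" "bdd_above (f ` S)"
  shows "(SUP x\<in>S. f x) < c \<longleftrightarrow> (\<exists>\<sigma><c. \<forall>x\<in>S. f x \<le> \<sigma>)"
proof
  assume "(SUP x\<in>S. f x) < c"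
  then show "\<exists>\<sigma><c. \<forall>x\<in>S. f x \<le> \<sigma>" using cSUP_upper[OF _ assms(2)] by blast
next
  assume "\<exists>\<sigma><c. \<forall>x\<in>S. f x \<le> \<sigma>"
  then obtain \<sigma> where "\<sigma> < c" "\<And>x. x \<in> S \<Longrightarrow> f x \<le> \<sigma>" by blast
  then show "(SUP x\<in>S. f x) < c" using cSUP_least[OF assms(1), of f \<sigma>] by simp
qed

lemma tetrablock_iff:
  "vector [x1, x2, x3] \<in> tetrablock \<longleftrightarrow>
    (\<forall>z1 z2. cmod z1 \<le> 1 \<longrightarrow> cmod z2 \<le> 1 \<longrightarrow> 1 - x1 * z1 - x2 * z2 + x3 * z1 * z2 \<noteq> 0)"
  by (auto simp: tetrablock_def vec_eq_iff forall_3)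

text \<open>The denominator has no zero on the compact closed bidisc, so the quotient is bounded and its
  supremum is below \<open>1\<close> exactly if some constant below \<open>1\<close> bounds all values. Clearing the
  denominator gives the form in which the condition is used.\<close>

lemma hexablock_iff:
  "vector [a, x1, x2, x3] \<in> hexablock \<longleftrightarrow> vector [x1, x2, x3] \<in> tetrablock \<and>
    (\<exists>\<sigma><1. \<forall>z1 z2. cmod z1 < 1 \<longrightarrow> cmod z2 < 1 \<longrightarrow>
      cmod a * sqrt ((1 - (cmod z1)\<^sup>2) * (1 - (cmod z2)\<^sup>2))
        \<le> \<sigma> * cmod (1 - x1 * z1 - x2 * z2 + x3 * z1 * z2))"
  (is "_ \<longleftrightarrow> ?E \<and> ?R")
proof -
  let ?den = "\<lambda>z1 z2. 1 - x1 * z1 - x2 * z2 + x3 * z1 * z2"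
  define f where "f z = cmod (a * complex_of_real (sqrt ((1 - (cmod (fst z))\<^sup>2) * (1 - (cmod (snd z))\<^sup>2)))
    / ?den (fst z) (snd z))" for z
  have mem: "vector [a, x1, x2, x3] \<in> hexablock \<longleftrightarrow> ?E \<and> (SUP z\<in>ball 0 1 \<times> ball 0 1. f z) < 1"
    unfolding hexablock_def f_def by (auto simp: vec_eq_iff forall_4 case_prod_unfold)
  have "(SUP z\<in>ball 0 1 \<times> ball 0 1. f z) < 1 \<longleftrightarrow> ?R" if E: ?E
  proof -
    have nz: "?den z1 z2 \<noteq> 0" if "cmod z1 \<le> 1" "cmod z2 \<le> 1" for z1 z2
      using E that unfolding tetrablock_iff by blast
    have "compact (f ` (cball 0 1 \<times> cball 0 1))"
      unfolding f_def by (intro compact_continuous_image compact_Times compact_cball continuous_intros) (auto simp: nz)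
    then have "bdd_above (f ` (ball 0 1 \<times> ball 0 1))"
      by (rule bdd_above_mono[OF bounded_imp_bdd_above[OF compact_imp_bounded]]) auto
    then have "(SUP z\<in>ball 0 1 \<times> ball 0 1. f z) < 1 \<longleftrightarrow> (\<exists>\<sigma><1. \<forall>z\<in>ball 0 1 \<times> ball 0 1. f z \<le> \<sigma>)"
      by (rule SUP_less_iff_bound[rotated]) auto
    also have "(\<lambda>\<sigma>. \<forall>z\<in>ball 0 1 \<times> ball 0 1. f z \<le> \<sigma>) = (\<lambda>\<sigma>. \<forall>z1 z2. cmod z1 < 1 \<longrightarrow> cmod z2 < 1 \<longrightarrow>
      cmod a * sqrt ((1 - (cmod z1)\<^sup>2) * (1 - (cmod z2)\<^sup>2)) \<le> \<sigma> * cmod (?den z1 z2))"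
    proof -
      have "f (z1, z2) \<le> \<sigma> \<longleftrightarrow> cmod a * sqrt ((1 - (cmod z1)\<^sup>2) * (1 - (cmod z2)\<^sup>2)) \<le> \<sigma> * cmod (?den z1 z2)"
        if z: "cmod z1 < 1" "cmod z2 < 1" for z1 z2 \<sigma>
      proof -
        have "0 \<le> (1 - (cmod z1)\<^sup>2) * (1 - (cmod z2)\<^sup>2)"
          using z by (intro mult_nonneg_nonneg) (simp_all add: power_le_one)
        moreover have "cmod (?den z1 z2) > 0" using nz[of z1 z2] z by simp
        ultimately show ?thesis by (simp add: f_def norm_divide norm_mult divide_le_eq)
      qed
      then show ?thesis by (auto simp: fun_eq_iff)
    qed
    finally show ?thesis by simp
  qed
  then show ?thesis using mem by blast
qed

lemma symmetrized_bidisc_iff: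
  "vector [s, p] \<in> symmetrized_bidisc \<longleftrightarrow> (\<exists>\<kappa> \<mu>. cmod \<kappa> < 1 \<and> cmod \<mu> < 1 \<and> s = \<kappa> + \<mu> \<and> p = \<kappa> * \<mu>)"
  by (auto simp: symmetrized_bidisc_def vec_eq_iff forall_2)

lemma symmetrized_bidisc_nonzero:
  assumes "vector [s, p] \<in> symmetrized_bidisc" "cmod z \<le> 1"
  shows "1 - s * z + p * z\<^sup>2 \<noteq> 0"
proof -
  obtain \<kappa> \<mu> where lm: "cmod \<kappa> < 1" "cmod \<mu> < 1" "s = \<kappa> + \<mu>" "p = \<kappa> * \<mu>"
    using assms(1) unfolding symmetrized_bidisc_iff by blast
  have "a * z \<noteq> 1" if "cmod a < 1" for a
  proof
    assume "a * z = 1"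
    then have "cmod a * cmod z = 1" by (simp add: norm_mult[symmetric])
    moreover have "cmod a * cmod z \<le> cmod a" using assms(2) by (simp add: mult_left_le)
    ultimately show False using that by simp
  qed
  then have "(1 - \<kappa> * z) * (1 - \<mu> * z) \<noteq> 0" using lm by auto
  then show ?thesis by (simp add: lm algebra_simps power2_eq_square)
qed

lemma pentablock_iff:
  "vector [a, s, p] \<in> pentablock \<longleftrightarrow> vector [s, p] \<in> symmetrized_bidisc \<and>
    (\<exists>\<sigma><1. \<forall>z. cmod z < 1 \<longrightarrow> cmod a * (1 - (cmod z)\<^sup>2) \<le> \<sigma> * cmod (1 - s * z + p * z\<^sup>2))"
  (is "_ \<longleftrightarrow> ?E \<and> ?R")
proof -
  define f where "f z = cmod (a * complex_of_real (1 - (cmod z)\<^sup>2) / (1 - s * z + p * z\<^sup>2))" for z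
  have mem: "vector [a, s, p] \<in> pentablock \<longleftrightarrow> ?E \<and> (SUP z\<in>ball 0 1. f z) < 1"
    unfolding pentablock_def f_def by (auto simp: vec_eq_iff forall_3)
  have "(SUP z\<in>ball 0 1. f z) < 1 \<longleftrightarrow> ?R" if E: ?E
  proof -
    note nz = symmetrized_bidisc_nonzero[OF E]
    have "compact (f ` cball 0 1)"
      unfolding f_def by (intro compact_continuous_image compact_cball continuous_intros) (auto simp: nz)
    then have "bdd_above (f ` ball 0 1)"
      by (rule bdd_above_mono[OF bounded_imp_bdd_above[OF compact_imp_bounded]]) auto
    then have "(SUP z\<in>ball 0 1. f z) < 1 \<longleftrightarrow> (\<exists>\<sigma><1. \<forall>z\<in>ball 0 1. f z \<le> \<sigma>)"
      by (rule SUP_less_iff_bound[rotated]) auto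
    also have "(\<lambda>\<sigma>. \<forall>z\<in>ball 0 1. f z \<le> \<sigma>)
      = (\<lambda>\<sigma>. \<forall>z. cmod z < 1 \<longrightarrow> cmod a * (1 - (cmod z)\<^sup>2) \<le> \<sigma> * cmod (1 - s * z + p * z\<^sup>2))"
    proof -
      have "f z \<le> \<sigma> \<longleftrightarrow> cmod a * (1 - (cmod z)\<^sup>2) \<le> \<sigma> * cmod (1 - s * z + p * z\<^sup>2)" if z: "cmod z < 1" for z \<sigma>
      proof -
        have "cmod (complex_of_real (1 - (cmod z)\<^sup>2)) = 1 - (cmod z)\<^sup>2"
          unfolding norm_of_real using z by (simp add: power_le_one)
        moreover have "cmod (1 - s * z + p * z\<^sup>2) > 0" using nz[of z] z by simp
        ultimately show ?thesis unfolding f_def norm_divide norm_mult by (simp add: divide_le_eq)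
      qed
      then show ?thesis by (auto simp: fun_eq_iff)
    qed
    finally show ?thesis by simp
  qed
  then show ?thesis using mem by blast
qed

section \<open>Maps between the domains\<close>

text \<open>The identity behind the invariance of the pseudohyperbolic distance.\<close>

lemma cmod_sq_diff:
  "(cmod (1 - cnj m * z))\<^sup>2 - (cmod (z - m))\<^sup>2 = (1 - (cmod m)\<^sup>2) * (1 - (cmod z)\<^sup>2)"
  unfolding cmod_power2 by (simp add: algebra_simps power2_eq_square)

lemma one_minus_mult_nonzero:
  fixes a b :: complex
  assumes "cmod a \<le> 1" "cmod b < 1"
  shows "1 - a * b \<noteq> 0"
proof
  assume "1 - a * b = 0"
  then have "cmod a * cmod b = 1" by (simp add: norm_mult[symmetric])
  moreover have "cmod a * cmod b \<le> cmod b" using assms(1) by (simp add: mult_left_le_one_le)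
  ultimately show False using assms by simp
qed

text \<open>The points are \<open>z\<^sub>1 = (m + w)/(1 + m\<^sup>* w)\<close> and \<open>z\<^sub>2 = (m - w)/(1 - m\<^sup>* w)\<close>, with \<open>m\<^sup>*\<close> the conjugate of \<open>m\<close>. With
  \<open>s = z\<^sub>1 + z\<^sub>2\<close> and \<open>p = z\<^sub>1 z\<^sub>2\<close>, eliminating \<open>w\<close> gives \<open>(1 + \<bar>m\<bar>\<^sup>2) s = 2 m + 2 m\<^sup>* p\<close>. So \<open>M = 2 m/(1 + \<bar>m\<bar>\<^sup>2)\<close>
  solves \<open>s = M + M\<^sup>* p\<close>, whose solution is \<open>(s - s\<^sup>* p)/(1 - \<bar>p\<bar>\<^sup>2)\<close> and has modulus below \<open>1\<close>, and \<open>m\<close> is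
  recovered from \<open>M\<close>.\<close>

lemma hyperbolic_midpoint:
  assumes z: "cmod z1 < 1" "cmod z2 < 1"
  obtains m w where "cmod m < 1" "cmod w < 1" "z1 * (1 + cnj m * w) = m + w" "z2 * (1 - cnj m * w) = m - w"
proof -
  define s p where "s = z1 + z2" and "p = z1 * z2"
  define r1 r2 where "r1 = cmod z1" and "r2 = cmod z2"
  have r: "0 \<le> r1" "r1 < 1" "0 \<le> r2" "r2 < 1" using z by (auto simp: r1_def r2_def)
  have r12: "r1 * r2 < 1" using r mult_left_mono[of r2 1 r1] by simp
  define M where "M = (s - cnj s * p) / (1 - p * cnj p)"
  have "cmod p = r1 * r2" by (simp add: p_def norm_mult r1_def r2_def)
  then have pp: "p * cnj p = complex_of_real ((r1 * r2)\<^sup>2)"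
    using complex_norm_square[of p] by simp
  have pos: "0 < 1 - (r1 * r2)\<^sup>2" using r r12 by (simp add: abs_square_less_1)
  have nz: "1 - p * cnj p \<noteq> 0"
    using pos unfolding pp by (metis of_real_1 of_real_diff of_real_eq_0_iff less_irrefl)
  have M1: "cmod M < 1"
  proof -
    have "s - cnj s * p = complex_of_real (1 - r2\<^sup>2) * z1 + complex_of_real (1 - r1\<^sup>2) * z2"
      unfolding of_real_diff r1_def r2_def complex_norm_square by (simp add: s_def p_def algebra_simps)
    then have "cmod (s - cnj s * p) \<le> (1 - r2\<^sup>2) * r1 + (1 - r1\<^sup>2) * r2"
      using norm_triangle_ineq[of "complex_of_real (1 - r2\<^sup>2) * z1" "complex_of_real (1 - r1\<^sup>2) * z2"] r
      by (simp add: norm_mult r1_def r2_def power_le_one del: of_real_diff)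
    also have "\<dots> = (1 - r1 * r2) * (r1 + r2)" by (simp add: algebra_simps power2_eq_square)
    also have "\<dots> < (1 - r1 * r2) * (1 + r1 * r2)"
    proof (rule mult_strict_left_mono)
      have "0 < (1 - r1) * (1 - r2)" using r by simp
      then show "r1 + r2 < 1 + r1 * r2" by (simp add: algebra_simps)
    qed (use r12 in simp)
    also have "\<dots> = 1 - (r1 * r2)\<^sup>2" by (simp add: algebra_simps power2_eq_square)
    finally have "cmod (s - cnj s * p) < 1 - (r1 * r2)\<^sup>2" .
    moreover have "cmod (1 - p * cnj p) = 1 - (r1 * r2)\<^sup>2"
      unfolding pp using pos by (metis abs_of_pos norm_of_real of_real_1 of_real_diff)
    ultimately show ?thesis using pos by (simp add: M_def norm_divide)
  qed
  have Ms: "M + cnj M * p = s"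
  proof -
    have "M * (1 - p * cnj p) = s - cnj s * p" using nz by (simp add: M_def)
    moreover have "cnj M * (1 - p * cnj p) = cnj s - s * cnj p"
      using arg_cong[OF calculation, of cnj] by (simp add: mult.commute)
    moreover have "(M + cnj M * p) * (1 - p * cnj p) = M * (1 - p * cnj p) + cnj M * (1 - p * cnj p) * p"
      by (simp add: algebra_simps)
    ultimately have "(M + cnj M * p) * (1 - p * cnj p) = s * (1 - p * cnj p)"
      by (simp only:) (simp add: algebra_simps)
    then show ?thesis using nz by simp
  qed
  define k where "k = sqrt (1 - (cmod M)\<^sup>2)"
  have k: "k > 0" "k\<^sup>2 = 1 - (cmod M)\<^sup>2" using M1 by (auto simp: k_def abs_square_less_1 power_le_one)
  define m where "m = M / complex_of_real (1 + k)"
  have mk: "(cmod m)\<^sup>2 = (1 - k) / (1 + k)"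
  proof -
    have "(cmod m)\<^sup>2 = (1 - k\<^sup>2) / (1 + k)\<^sup>2"
      using k by (simp add: m_def norm_divide power_divide del: of_real_add)
    also have "1 - k\<^sup>2 = (1 - k) * (1 + k)" by (simp add: algebra_simps power2_eq_square)
    finally show ?thesis using k by (simp add: power2_eq_square)
  qed
  have "(cmod m)\<^sup>2 < 1" using k by (simp add: mk)
  then have m1: "cmod m < 1" by (simp add: abs_square_less_1)
  have mM: "complex_of_real (1 + (cmod m)\<^sup>2) * M = 2 * m"
  proof -
    have "1 + (cmod m)\<^sup>2 = 2 / (1 + k)" using k by (simp add: mk field_simps)
    then show ?thesis by (simp only: m_def) simp
  qed
  have e: "complex_of_real (1 + (cmod m)\<^sup>2) = 1 + m * cnj m"
    using complex_norm_square[of m] by simp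
  have "complex_of_real (1 + (cmod m)\<^sup>2) * cnj M = 2 * cnj m"
    using arg_cong[OF mM, of cnj] by (simp only: complex_cnj_mult complex_cnj_complex_of_real complex_cnj_numeral)
  then have key: "(1 + m * cnj m) * s = 2 * m + 2 * cnj m * p"
    unfolding Ms[symmetric] e[symmetric] using mM by (simp only: distrib_left mult.assoc[symmetric])
  have nz1: "1 - cnj m * z1 \<noteq> 0" using m1 z by (intro one_minus_mult_nonzero) auto
  define w where "w = (z1 - m) / (1 - cnj m * z1)"
  have w: "w * (1 - cnj m * z1) = z1 - m" using nz1 by (simp add: w_def)
  show thesis
  proof (rule that[of m w])
    have "0 < (1 - (cmod m)\<^sup>2) * (1 - (cmod z1)\<^sup>2)"
      using m1 z by (intro mult_pos_pos) (simp_all add: abs_square_less_1)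
    then have "(cmod (z1 - m))\<^sup>2 < (cmod (1 - cnj m * z1))\<^sup>2" using cmod_sq_diff[of m z1] by simp
    then have "cmod (z1 - m) < cmod (1 - cnj m * z1)" by (rule power_less_imp_less_base) simp
    then show "cmod w < 1" using nz1 by (simp add: w_def norm_divide)
    show "z1 * (1 + cnj m * w) = m + w" using w by (simp add: algebra_simps)
    have "(z2 * (1 - cnj m * w)) * (1 - cnj m * z1) = z2 * (1 - cnj m * z1) - z2 * cnj m * (w * (1 - cnj m * z1))"
      by (simp add: algebra_simps)
    also have "\<dots> = z2 * (1 - cnj m * z1) - z2 * cnj m * (z1 - m)" unfolding w ..
    also have "\<dots> = m * (1 - cnj m * z1) - (z1 - m)"
      using key by (simp add: s_def p_def algebra_simps)
    also have "\<dots> = (m - w) * (1 - cnj m * z1)" unfolding w[symmetric] by (simp add: algebra_simps)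
    finally show "z2 * (1 - cnj m * w) = m - w" using nz1 by simp
  qed (rule m1)
qed

text \<open>In the coordinate centred at the hyperbolic midpoint \<open>m\<close>, the factor \<open>1 - c z\<close> becomes
  \<open>\<alpha>(c) + \<beta>(c) w\<close>, up to a denominator that also comes out of the weights \<open>1 - \<bar>z\<^sub>j\<bar>\<^sup>2\<close>. Here
  \<open>\<bar>\<beta>(c)\<bar> \<le> \<bar>\<alpha>(c)\<bar>\<close>, and the polarised product at \<open>w\<close> and \<open>-w\<close> becomes
  \<open>\<alpha>(\<kappa>) \<alpha>(\<mu>) - \<beta>(\<kappa>) \<beta>(\<mu>) w\<^sup>2\<close>, of modulus at least \<open>\<bar>\<alpha>(\<kappa>) \<alpha>(\<mu>)\<bar> (1 - \<bar>w\<bar>\<^sup>2)\<close>. Finally \<open>\<alpha>(\<kappa>) \<alpha>(\<mu>)\<close> is the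
  value of the original product at \<open>m\<close>.\<close>

lemma polarization_bound:
  assumes lm: "cmod \<kappa> \<le> 1" "cmod \<mu> \<le> 1" and z: "cmod z1 < 1" "cmod z2 < 1"
  obtains m where "cmod m < 1"
    "cmod ((1 - \<kappa> * m) * (1 - \<mu> * m)) * sqrt ((1 - (cmod z1)\<^sup>2) * (1 - (cmod z2)\<^sup>2))
      \<le> cmod (1 - (\<kappa> + \<mu>) / 2 * z1 - (\<kappa> + \<mu>) / 2 * z2 + \<kappa> * \<mu> * z1 * z2) * (1 - (cmod m)\<^sup>2)"
proof -
  obtain m w where m: "cmod m < 1" and w: "cmod w < 1"
    and z1: "z1 * (1 + cnj m * w) = m + w" and z2: "z2 * (1 - cnj m * w) = m - w"
    using hyperbolic_midpoint[OF z] .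
  define q where "q = 1 - (\<kappa> + \<mu>) / 2 * z1 - (\<kappa> + \<mu>) / 2 * z2 + \<kappa> * \<mu> * z1 * z2"
  define N where "N = 1 - (cmod m)\<^sup>2"
  define W where "W = 1 - (cmod w)\<^sup>2"
  define d1 d2 where "d1 = 1 + cnj m * w" and "d2 = 1 - cnj m * w"
  have N: "N > 0" and W: "W > 0" using m w by (simp_all add: N_def W_def abs_square_less_1)
  have d: "d1 \<noteq> 0" "d2 \<noteq> 0"
    using one_minus_mult_nonzero[of "- cnj m" w] one_minus_mult_nonzero[of "cnj m" w] m w
    by (simp_all add: d1_def d2_def)
  have "(cmod z1 * cmod d1)\<^sup>2 = (cmod (m + w))\<^sup>2"
    using z1 by (simp add: norm_mult[symmetric] d1_def)
  then have n1: "(1 - (cmod z1)\<^sup>2) * (cmod d1)\<^sup>2 = N * W"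
    using cmod_sq_diff[of "- m" w]
    by (simp add: d1_def N_def W_def power_mult_distrib algebra_simps)
  have "(cmod z2 * cmod d2)\<^sup>2 = (cmod (m - w))\<^sup>2"
    using z2 by (simp add: norm_mult[symmetric] d2_def)
  then have n2: "(1 - (cmod z2)\<^sup>2) * (cmod d2)\<^sup>2 = N * W"
    using cmod_sq_diff[of m w]
    by (simp add: d2_def N_def W_def power_mult_distrib algebra_simps norm_minus_commute)
  have sq: "sqrt ((1 - (cmod z1)\<^sup>2) * (1 - (cmod z2)\<^sup>2)) * cmod (d1 * d2) = N * W"
  proof -
    have "sqrt ((1 - (cmod z1)\<^sup>2) * (1 - (cmod z2)\<^sup>2)) * cmod (d1 * d2)
        = sqrt (((1 - (cmod z1)\<^sup>2) * (1 - (cmod z2)\<^sup>2)) * (cmod (d1 * d2))\<^sup>2)"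
      by (simp add: real_sqrt_mult)
    also have "\<dots> = sqrt ((N * W)\<^sup>2)"
      unfolding norm_mult power_mult_distrib using n1 n2 by (simp add: power2_eq_square mult_ac)
    finally show ?thesis using N W by simp
  qed
  define \<alpha> \<beta> where "\<alpha> c = 1 - c * m" and "\<beta> c = cnj m - c" for c
  have ab: "cmod (\<beta> c) \<le> cmod (\<alpha> c)" if "cmod c \<le> 1" for c
  proof -
    have "0 \<le> (1 - (cmod (cnj c))\<^sup>2) * (1 - (cmod m)\<^sup>2)"
      using that m by (intro mult_nonneg_nonneg) (simp_all add: power_le_one)
    also have "\<dots> = (cmod (\<alpha> c))\<^sup>2 - (cmod (m - cnj c))\<^sup>2"
      using cmod_sq_diff[of "cnj c" m] by (simp add: \<alpha>_def)
    also have "cmod (m - cnj c) = cmod (\<beta> c)"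
      by (metis \<beta>_def complex_cnj_cnj complex_cnj_diff complex_mod_cnj)
    finally show ?thesis by (simp add: power2_le_iff_abs_le)
  qed
  have f1: "(1 - c * z1) * d1 = \<alpha> c + \<beta> c * w" for c
    using z1 by (simp add: d1_def \<alpha>_def \<beta>_def algebra_simps) (metis distrib_left)
  have f2: "(1 - c * z2) * d2 = \<alpha> c - \<beta> c * w" for c
    using z2 by (simp add: d2_def \<alpha>_def \<beta>_def algebra_simps) (metis distrib_left add_diff_eq)
  have qeq: "q = ((1 - \<kappa> * z1) * (1 - \<mu> * z2) + (1 - \<mu> * z1) * (1 - \<kappa> * z2)) / 2"
    by (simp add: q_def field_simps)
  have "q * (d1 * d2) = (((1 - \<kappa> * z1) * d1) * ((1 - \<mu> * z2) * d2) + ((1 - \<mu> * z1) * d1) * ((1 - \<kappa> * z2) * d2)) / 2"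
    unfolding qeq by (simp add: algebra_simps add_divide_distrib)
  also have "\<dots> = \<alpha> \<kappa> * \<alpha> \<mu> - \<beta> \<kappa> * \<beta> \<mu> * w\<^sup>2"
    unfolding f1 f2 by (simp add: field_simps power2_eq_square)
  finally have q: "q * (d1 * d2) = \<alpha> \<kappa> * \<alpha> \<mu> - \<beta> \<kappa> * \<beta> \<mu> * w\<^sup>2" .
  have "cmod (\<beta> \<kappa> * \<beta> \<mu> * w\<^sup>2) \<le> cmod (\<alpha> \<kappa> * \<alpha> \<mu>) * (cmod w)\<^sup>2"
    unfolding norm_mult norm_power using lm by (intro mult_right_mono mult_mono ab) auto
  then have "cmod (\<alpha> \<kappa> * \<alpha> \<mu>) * W \<le> cmod (q * (d1 * d2))"
    using norm_triangle_ineq2[of "\<alpha> \<kappa> * \<alpha> \<mu>" "\<beta> \<kappa> * \<beta> \<mu> * w\<^sup>2"] unfolding q W_def by (simp add: algebra_simps)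
  then have "cmod (\<alpha> \<kappa> * \<alpha> \<mu>) * W * N \<le> cmod (q * (d1 * d2)) * N"
    using N by (simp add: mult_right_mono)
  then have "(cmod (\<alpha> \<kappa> * \<alpha> \<mu>) * sqrt ((1 - (cmod z1)\<^sup>2) * (1 - (cmod z2)\<^sup>2))) * cmod (d1 * d2)
      \<le> (cmod q * N) * cmod (d1 * d2)"
    using sq by (simp add: norm_mult mult_ac)
  then have "cmod (\<alpha> \<kappa> * \<alpha> \<mu>) * sqrt ((1 - (cmod z1)\<^sup>2) * (1 - (cmod z2)\<^sup>2)) \<le> cmod q * N"
    using d by (simp add: mult_le_cancel_right)
  then show thesis using that[OF m] by (simp add: \<alpha>_def q_def N_def)
qed


text \<open>On the diagonal the denominator of the tetrablock is \<open>1 - (x\<^sub>1 + x\<^sub>2) z + x\<^sub>3 z\<^sup>2\<close>. Its zeros are the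
  reciprocals of the two numbers with sum \<open>x\<^sub>1 + x\<^sub>2\<close> and product \<open>x\<^sub>3\<close>.\<close>

lemma tetrablock_symmetrized:
  assumes "vector [x1, x2, x3] \<in> tetrablock"
  shows "vector [x1 + x2, x3] \<in> symmetrized_bidisc"
proof -
  define s d where "s = x1 + x2" and "d = csqrt (s\<^sup>2 - 4 * x3)"
  have d: "d * d = s * s - 4 * x3" using power2_csqrt[of "s\<^sup>2 - 4 * x3"] by (simp add: d_def power2_eq_square)
  have root: "cmod l < 1" if "l * l - s * l + x3 = 0" for l
  proof (rule ccontr)
    assume "\<not> cmod l < 1"
    then have l: "l \<noteq> 0" "cmod (1 / l) \<le> 1" by (auto simp: norm_divide divide_le_eq)
    then have "1 - x1 * (1 / l) - x2 * (1 / l) + x3 * (1 / l) * (1 / l) \<noteq> 0"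
      using assms unfolding tetrablock_iff by blast
    moreover have "(1 - x1 * (1 / l) - x2 * (1 / l) + x3 * (1 / l) * (1 / l)) * (l * l) = l * l - s * l + x3"
      using l(1) by (simp add: s_def field_simps)
    ultimately show False using that l(1) by simp
  qed
  have half: "cmod ((s + e) / 2) < 1" if "e * e = d * d" for e
  proof (rule root)
    have "(s + e) / 2 * ((s + e) / 2) - s * ((s + e) / 2) + x3 = (e * e - s * s) / 4 + x3"
      by (simp add: field_simps)
    then show "(s + e) / 2 * ((s + e) / 2) - s * ((s + e) / 2) + x3 = 0" by (simp add: that d)
  qed
  show ?thesis unfolding symmetrized_bidisc_iff
  proof (intro exI conjI)
    show "cmod ((s + d) / 2) < 1" "cmod ((s - d) / 2) < 1"
      using half[of d] half[of "- d"] by simp_all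
    show "x1 + x2 = (s + d) / 2 + (s - d) / 2" by (simp add: s_def field_simps)
    show "x3 = (s + d) / 2 * ((s - d) / 2)" using d by (simp add: field_simps)
  qed
qed

lemma symmetrized_bidisc_coordinates:
  assumes "vector [s, p] \<in> symmetrized_bidisc"
  shows "cmod s < 2" "cmod p < 1"
proof -
  obtain \<kappa> \<mu> where km: "cmod \<kappa> < 1" "cmod \<mu> < 1" "s = \<kappa> + \<mu>" "p = \<kappa> * \<mu>"
    using assms unfolding symmetrized_bidisc_iff by blast
  show "cmod s < 2" using km norm_triangle_ineq[of \<kappa> \<mu>] by simp
  show "cmod p < 1" using km mult_left_mono[of "cmod \<mu>" 1 "cmod \<kappa>"] by (simp add: norm_mult)
qed

lemma tetrablock_coordinates:
  assumes "vector [x1, x2, x3] \<in> tetrablock"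
  shows "cmod x1 < 1" "cmod x2 < 1" "cmod x3 < 1"
proof -
  have nz: "1 - x1 * z1 - x2 * z2 + x3 * z1 * z2 \<noteq> 0" if "cmod z1 \<le> 1" "cmod z2 \<le> 1" for z1 z2
    using assms that unfolding tetrablock_iff by blast
  show "cmod x1 < 1"
  proof (rule ccontr)
    assume "\<not> cmod x1 < 1"
    then have "x1 \<noteq> 0" "cmod (1 / x1) \<le> 1" by (auto simp: norm_divide divide_le_eq)
    then show False using nz[of "1 / x1" 0] by simp
  qed
  show "cmod x2 < 1"
  proof (rule ccontr)
    assume "\<not> cmod x2 < 1"
    then have "x2 \<noteq> 0" "cmod (1 / x2) \<le> 1" by (auto simp: norm_divide divide_le_eq)
    then show False using nz[of 0 "1 / x2"] by simp
  qed
  show "cmod x3 < 1"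
    by (rule symmetrized_bidisc_coordinates(2)[OF tetrablock_symmetrized[OF assms]])
qed

text \<open>Polarisation does not create zeros in the closed disc. The two numbers with sum \<open>s\<close> and product \<open>p\<close>
  lie strictly inside the disc, so a factor \<open>r < 1\<close> can be moved from them to the points \<open>z\<^sub>1, z\<^sub>2\<close>, which
  brings these into the open disc, where the midpoint bound applies.\<close>

lemma symmetrized_tetrablock:
  assumes "vector [s, p] \<in> symmetrized_bidisc"
  shows "vector [s / 2, s / 2, p] \<in> tetrablock"
  unfolding tetrablock_iff
proof (intro allI impI)
  fix z1 z2 :: complex assume z: "cmod z1 \<le> 1" "cmod z2 \<le> 1"
  obtain \<kappa> \<mu> where km: "cmod \<kappa> < 1" "cmod \<mu> < 1" "s = \<kappa> + \<mu>" "p = \<kappa> * \<mu>"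
    using assms unfolding symmetrized_bidisc_iff by blast
  define r where "r = (1 + max (cmod \<kappa>) (cmod \<mu>)) / 2"
  have r: "0 < r" "r < 1" "cmod \<kappa> \<le> r" "cmod \<mu> \<le> r"
    using km by (auto simp: r_def max_def intro: add_pos_nonneg)
  define k l where "k = \<kappa> / complex_of_real r" and "l = \<mu> / complex_of_real r"
  have kl: "cmod k \<le> 1" "cmod l \<le> 1" using r by (simp_all add: k_def l_def norm_divide)
  have rz: "cmod (complex_of_real r * z) < 1" if "cmod z \<le> 1" for z
  proof -
    have "cmod (complex_of_real r * z) \<le> r * 1"
      unfolding norm_mult using r that by (intro mult_mono) auto
    then show ?thesis using r by simp
  qed
  obtain m where m: "cmod m < 1" and le:
    "cmod ((1 - k * m) * (1 - l * m)) * sqrt ((1 - (cmod (complex_of_real r * z1))\<^sup>2) * (1 - (cmod (complex_of_real r * z2))\<^sup>2))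
      \<le> cmod (1 - (k + l) / 2 * (complex_of_real r * z1) - (k + l) / 2 * (complex_of_real r * z2)
          + k * l * (complex_of_real r * z1) * (complex_of_real r * z2)) * (1 - (cmod m)\<^sup>2)"
    using polarization_bound[OF kl rz[OF z(1)] rz[OF z(2)]] .
  have "0 < cmod ((1 - k * m) * (1 - l * m)) * sqrt ((1 - (cmod (complex_of_real r * z1))\<^sup>2) * (1 - (cmod (complex_of_real r * z2))\<^sup>2))"
    using one_minus_mult_nonzero[OF kl(1) m] one_minus_mult_nonzero[OF kl(2) m] rz[OF z(1)] rz[OF z(2)]
    by (intro mult_pos_pos) (simp_all add: abs_square_less_1 del: norm_mult)
  also note le
  also have "(1 - (k + l) / 2 * (complex_of_real r * z1) - (k + l) / 2 * (complex_of_real r * z2)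
          + k * l * (complex_of_real r * z1) * (complex_of_real r * z2)) = 1 - s / 2 * z1 - s / 2 * z2 + p * z1 * z2"
    using r by (simp add: k_def l_def km(3,4) field_simps)
  finally show "1 - s / 2 * z1 - s / 2 * z2 + p * z1 * z2 \<noteq> 0" by auto
qed

lemma hexablock_coordinates:
  assumes "vector [a, x1, x2, x3] \<in> hexablock"
  shows "cmod a < 1" "cmod x1 < 1" "cmod x2 < 1" "cmod x3 < 1"
proof -
  obtain \<sigma> where E: "vector [x1, x2, x3] \<in> tetrablock" and \<sigma>: "\<sigma> < 1"
    "\<forall>z1 z2. cmod z1 < 1 \<longrightarrow> cmod z2 < 1 \<longrightarrow> cmod a * sqrt ((1 - (cmod z1)\<^sup>2) * (1 - (cmod z2)\<^sup>2))
        \<le> \<sigma> * cmod (1 - x1 * z1 - x2 * z2 + x3 * z1 * z2)"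
    using assms unfolding hexablock_iff by blast
  show "cmod a < 1" using \<sigma>(2)[rule_format, of 0 0] \<sigma>(1) by simp
  show "cmod x1 < 1" "cmod x2 < 1" "cmod x3 < 1" by (fact tetrablock_coordinates[OF E])+
qed

lemma ball2_iff: "vector [a, x] \<in> ball2 \<longleftrightarrow> (cmod a)\<^sup>2 + (cmod x)\<^sup>2 < 1"
proof -
  have "norm (vector [a, x] :: complex ^ 2) = sqrt ((cmod a)\<^sup>2 + (cmod x)\<^sup>2)"
    by (simp add: norm_vec_def L2_set_def sum_2)
  then show ?thesis by (simp add: ball2_def)
qed

text \<open>The estimate is sharp at \<open>z\<^sub>1 = x\<^sup>*\<close>, the conjugate of \<open>x\<close>, and \<open>z\<^sub>2 = 0\<close>, because
  \<open>(1 - \<bar>x\<bar> t)\<^sup>2 - (1 - t\<^sup>2)(1 - \<bar>x\<bar>\<^sup>2) = (\<bar>x\<bar> - t)\<^sup>2\<close>. The same point gives the converse inclusion.\<close>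

lemma ball2_hexablock:
  assumes "vector [a, x] \<in> ball2"
  shows "vector [a, x, 0, 0] \<in> hexablock"
proof -
  have ax: "(cmod a)\<^sup>2 + (cmod x)\<^sup>2 < 1" using assms by (simp add: ball2_iff)
  then have x: "(cmod x)\<^sup>2 < 1" using zero_le_power2[of "cmod a"] by linarith
  then have x1: "cmod x < 1" by (simp add: abs_square_less_1)
  define c where "c = sqrt (1 - (cmod x)\<^sup>2)"
  have c: "c > 0" "c\<^sup>2 = 1 - (cmod x)\<^sup>2" using x by (simp_all add: c_def)
  have "cmod a < c" using ax c by (intro power_less_imp_less_base[of "cmod a" 2 c]) auto
  then have \<sigma>: "cmod a / c < 1" using c by simp
  have "cmod a * sqrt ((1 - (cmod z1)\<^sup>2) * (1 - (cmod z2)\<^sup>2)) \<le> cmod a / c * cmod (1 - x * z1)"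
    if z: "cmod z1 < 1" "cmod z2 < 1" for z1 z2
  proof -
    define t where "t = cmod z1"
    have t: "0 \<le> t" "t < 1" using z by (auto simp: t_def)
    then have t2: "t\<^sup>2 < 1" by (simp add: abs_square_less_1)
    have xt: "cmod x * t \<le> 1" using x1 t by (simp add: mult_le_one)
    have "sqrt ((1 - (cmod z1)\<^sup>2) * (1 - (cmod z2)\<^sup>2)) \<le> sqrt (1 - t\<^sup>2)"
      using z t2 by (simp add: t_def mult_left_le)
    moreover have "sqrt (1 - t\<^sup>2) * c \<le> 1 - cmod x * t"
    proof (rule power2_le_imp_le)
      have "(sqrt (1 - t\<^sup>2) * c)\<^sup>2 = (1 - t\<^sup>2) * (1 - (cmod x)\<^sup>2)"
        using t2 by (simp add: power_mult_distrib c(2))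
      also have "\<dots> = (1 - cmod x * t)\<^sup>2 - (cmod x - t)\<^sup>2" by (simp add: algebra_simps power2_eq_square)
      finally show "(sqrt (1 - t\<^sup>2) * c)\<^sup>2 \<le> (1 - cmod x * t)\<^sup>2" by simp
    qed (use xt in simp)
    moreover have "1 - cmod x * t \<le> cmod (1 - x * z1)"
      using norm_triangle_ineq2[of 1 "x * z1"] by (simp add: norm_mult t_def)
    ultimately have "sqrt ((1 - (cmod z1)\<^sup>2) * (1 - (cmod z2)\<^sup>2)) * c \<le> cmod (1 - x * z1)"
      using mult_right_mono[of "sqrt ((1 - (cmod z1)\<^sup>2) * (1 - (cmod z2)\<^sup>2))" "sqrt (1 - t\<^sup>2)" c] c(1) by linarith
    then have "cmod a * (sqrt ((1 - (cmod z1)\<^sup>2) * (1 - (cmod z2)\<^sup>2)) * c) \<le> cmod a * cmod (1 - x * z1)"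
      by (intro mult_left_mono) auto
    then show ?thesis using c(1) by (simp add: field_simps)
  qed
  moreover have "vector [x, 0, 0] \<in> tetrablock"
    using one_minus_mult_nonzero[OF _ x1] by (auto simp: tetrablock_iff mult.commute)
  ultimately show ?thesis unfolding hexablock_iff using \<sigma> by auto
qed

lemma hexablock_ball2:
  assumes "vector [a, x1, x2, x3] \<in> hexablock"
  shows "vector [a, x1] \<in> ball2"
proof -
  have x1: "cmod x1 < 1" by (rule hexablock_coordinates[OF assms])
  define d where "d = 1 - (cmod x1)\<^sup>2"
  have d: "d > 0" using x1 by (simp add: d_def abs_square_less_1)
  obtain \<sigma> where \<sigma>: "\<sigma> < 1"
    "\<forall>z1 z2. cmod z1 < 1 \<longrightarrow> cmod z2 < 1 \<longrightarrow> cmod a * sqrt ((1 - (cmod z1)\<^sup>2) * (1 - (cmod z2)\<^sup>2))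
        \<le> \<sigma> * cmod (1 - x1 * z1 - x2 * z2 + x3 * z1 * z2)"
    using assms unfolding hexablock_iff by blast
  have "1 - x1 * cnj x1 = complex_of_real d"
    using complex_norm_square[of x1] by (simp add: d_def)
  then have "cmod a * sqrt d \<le> \<sigma> * d"
    using \<sigma>(2)[rule_format, of "cnj x1" 0] x1 d by (simp add: d_def[symmetric])
  also have "\<dots> < 1 * d" using \<sigma>(1) d by (intro mult_strict_right_mono)
  also have "\<dots> = sqrt d * sqrt d" using d by simp
  finally have "cmod a < sqrt d" by (rule mult_right_less_imp_less) (use d in simp)
  then have "(cmod a)\<^sup>2 < (sqrt d)\<^sup>2" by (intro power_strict_mono) auto
  then show ?thesis using d by (simp add: ball2_iff d_def)
qed

lemma tetrablock_hexablock:
  assumes "vector [x1, x2, x3] \<in> tetrablock"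
  shows "vector [0, x1, x2, x3] \<in> hexablock"
  unfolding hexablock_iff using assms by (intro conjI exI[of _ 0]) auto

lemma hexablock_tetrablock: "vector [a, x1, x2, x3] \<in> hexablock \<Longrightarrow> vector [x1, x2, x3] \<in> tetrablock"
  by (simp add: hexablock_iff)

lemma pentablock_hexablock:
  assumes "vector [a, s, p] \<in> pentablock"
  shows "vector [a, s / 2, s / 2, p] \<in> hexablock"
proof -
  obtain \<sigma> where sp: "vector [s, p] \<in> symmetrized_bidisc" and \<sigma>: "\<sigma> < 1"
    "\<forall>z. cmod z < 1 \<longrightarrow> cmod a * (1 - (cmod z)\<^sup>2) \<le> \<sigma> * cmod (1 - s * z + p * z\<^sup>2)"
    using assms unfolding pentablock_iff by blast
  obtain \<kappa> \<mu> where km: "cmod \<kappa> < 1" "cmod \<mu> < 1" "s = \<kappa> + \<mu>" "p = \<kappa> * \<mu>"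
    using sp unfolding symmetrized_bidisc_iff by blast
  have \<sigma>0: "0 \<le> \<sigma>" using \<sigma>(2)[rule_format, of 0] by simp (metis norm_ge_zero order_trans)
  have "cmod a * sqrt ((1 - (cmod z1)\<^sup>2) * (1 - (cmod z2)\<^sup>2))
      \<le> \<sigma> * cmod (1 - s / 2 * z1 - s / 2 * z2 + p * z1 * z2)" (is "cmod a * ?S \<le> \<sigma> * ?Q")
    if z: "cmod z1 < 1" "cmod z2 < 1" for z1 z2
  proof -
    obtain m where m: "cmod m < 1" and le: "cmod ((1 - \<kappa> * m) * (1 - \<mu> * m)) * ?S \<le> ?Q * (1 - (cmod m)\<^sup>2)"
      using polarization_bound[of \<kappa> \<mu> z1 z2] km z by (metis less_imp_le)
    have S: "0 \<le> ?S" using z by (simp add: power_le_one)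
    have m2: "0 < 1 - (cmod m)\<^sup>2" using m by (simp add: abs_square_less_1)
    have eq: "1 - s * m + p * m\<^sup>2 = (1 - \<kappa> * m) * (1 - \<mu> * m)"
      by (simp add: km algebra_simps power2_eq_square)
    have "(cmod a * ?S) * (1 - (cmod m)\<^sup>2) = (cmod a * (1 - (cmod m)\<^sup>2)) * ?S" by simp
    also have "\<dots> \<le> (\<sigma> * cmod (1 - s * m + p * m\<^sup>2)) * ?S"
      by (intro mult_right_mono S \<sigma>(2)[rule_format, OF m])
    also have "\<dots> = \<sigma> * (cmod ((1 - \<kappa> * m) * (1 - \<mu> * m)) * ?S)" by (simp add: eq)
    also have "\<dots> \<le> \<sigma> * (?Q * (1 - (cmod m)\<^sup>2))" by (intro mult_left_mono le \<sigma>0)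
    finally have "(cmod a * ?S) * (1 - (cmod m)\<^sup>2) \<le> (\<sigma> * ?Q) * (1 - (cmod m)\<^sup>2)" by simp
    then show ?thesis using m2 by (rule mult_right_le_imp_le)
  qed
  then show ?thesis unfolding hexablock_iff using \<sigma>(1) symmetrized_tetrablock[OF sp] by blast
qed

lemma hexablock_pentablock:
  assumes "vector [a, x1, x2, x3] \<in> hexablock"
  shows "vector [a, x1 + x2, x3] \<in> pentablock"
proof -
  obtain \<sigma> where E: "vector [x1, x2, x3] \<in> tetrablock" and \<sigma>: "\<sigma> < 1"
    "\<forall>z1 z2. cmod z1 < 1 \<longrightarrow> cmod z2 < 1 \<longrightarrow> cmod a * sqrt ((1 - (cmod z1)\<^sup>2) * (1 - (cmod z2)\<^sup>2))
        \<le> \<sigma> * cmod (1 - x1 * z1 - x2 * z2 + x3 * z1 * z2)"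
    using assms unfolding hexablock_iff by blast
  have "cmod a * (1 - (cmod z)\<^sup>2) \<le> \<sigma> * cmod (1 - (x1 + x2) * z + x3 * z\<^sup>2)" if z: "cmod z < 1" for z
  proof -
    have e1: "1 - (x1 + x2) * z + x3 * z\<^sup>2 = 1 - x1 * z - x2 * z + x3 * z * z"
      by (simp add: algebra_simps power2_eq_square)
    have e2: "sqrt ((1 - (cmod z)\<^sup>2) * (1 - (cmod z)\<^sup>2)) = 1 - (cmod z)\<^sup>2"
      using z by (simp add: power_le_one)
    show ?thesis using \<sigma>(2)[rule_format, OF z z] unfolding e1 e2 .
  qed
  then show ?thesis unfolding pentablock_iff using \<sigma>(1) tetrablock_symmetrized[OF E] by blast
qed

text \<open>The bound reduces to \<open>(1 - t\<^sup>2)(1 - u\<^sup>2) = (1 - t u)\<^sup>2 - (t - u)\<^sup>2\<close> for the moduli \<open>t, u\<close> of the two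
  points.\<close>

lemma bidisc_hexablock:
  assumes a: "cmod a < 1" and x: "cmod x < 1"
  shows "vector [a, 0, 0, x] \<in> hexablock"
proof -
  have "cmod a * sqrt ((1 - (cmod z1)\<^sup>2) * (1 - (cmod z2)\<^sup>2)) \<le> cmod a * cmod (1 + x * z1 * z2)"
    if z: "cmod z1 < 1" "cmod z2 < 1" for z1 z2
  proof (intro mult_left_mono norm_ge_zero)
    define t u where "t = cmod z1" and "u = cmod z2"
    have t: "0 \<le> t" "t \<le> 1" "0 \<le> u" "u \<le> 1" using z by (auto simp: t_def u_def)
    then have tu: "t * u \<le> 1" by (simp add: mult_le_one)
    have "(1 - t\<^sup>2) * (1 - u\<^sup>2) = (1 - t * u)\<^sup>2 - (t - u)\<^sup>2" by (simp add: algebra_simps power2_eq_square)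
    then have "(1 - t\<^sup>2) * (1 - u\<^sup>2) \<le> (1 - t * u)\<^sup>2" by simp
    then have "sqrt ((1 - t\<^sup>2) * (1 - u\<^sup>2)) \<le> 1 - t * u" using tu by (simp add: real_le_lsqrt)
    also have "\<dots> \<le> 1 - cmod (x * z1 * z2)"
      using x t mult_right_mono[of "cmod x" 1 "t * u"] by (simp add: norm_mult t_def u_def mult.assoc)
    also have "\<dots> \<le> cmod (1 + x * z1 * z2)"
      using norm_triangle_ineq2[of 1 "- (x * z1 * z2)"] by simp
    finally show "sqrt ((1 - (cmod z1)\<^sup>2) * (1 - (cmod z2)\<^sup>2)) \<le> cmod (1 + x * z1 * z2)"
      by (simp add: t_def u_def)
  qed
  moreover have "vector [0, 0, x] \<in> tetrablock"
  proof -
    have "1 + x * z1 * z2 \<noteq> 0" if "cmod z1 \<le> 1" "cmod z2 \<le> 1" for z1 z2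
      using one_minus_mult_nonzero[of "- (z1 * z2)" x] x that by (simp add: norm_mult mult_le_one mult_ac)
    then show ?thesis by (simp add: tetrablock_iff)
  qed
  ultimately show ?thesis unfolding hexablock_iff using a by auto
qed

lemma bounded_domains:
  "bounded ball2" "bounded tetrablock" "bounded hexablock" "bounded pentablock" "bounded symmetrized_bidisc"
proof -
  show "bounded ball2" by (simp add: ball2_def)
  show "bounded tetrablock"
  proof (rule bounded_coordinates)
    fix z :: "complex ^ 3" and i assume "z \<in> tetrablock"
    then have "vector [z $ 1, z $ 2, z $ 3] \<in> tetrablock" by (simp add: vector_eta)
    from tetrablock_coordinates[OF this] show "cmod (z $ i) \<le> 2" using exhaust_3[of i] by auto
  qed
  show "bounded hexablock"
  proof (rule bounded_coordinates)
    fix z :: "complex ^ 4" and i assume "z \<in> hexablock"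
    then have "vector [z $ 1, z $ 2, z $ 3, z $ 4] \<in> hexablock" by (simp add: vector_eta)
    from hexablock_coordinates[OF this] show "cmod (z $ i) \<le> 2" using exhaust_4[of i] by auto
  qed
  show "bounded symmetrized_bidisc"
  proof (rule bounded_coordinates)
    fix z :: "complex ^ 2" and i assume "z \<in> symmetrized_bidisc"
    then have "vector [z $ 1, z $ 2] \<in> symmetrized_bidisc" by (simp add: vector_eta)
    from symmetrized_bidisc_coordinates[OF this] show "cmod (z $ i) \<le> 2" using exhaust_2[of i] by auto
  qed
  show "bounded pentablock"
  proof (rule bounded_coordinates)
    fix z :: "complex ^ 3" and i assume "z \<in> pentablock"
    then have z: "vector [z $ 1, z $ 2, z $ 3] \<in> pentablock" by (simp add: vector_eta)
    then have "vector [z $ 2, z $ 3] \<in> symmetrized_bidisc" by (simp add: pentablock_iff)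
    moreover have "cmod (z $ 1) < 1"
      by (rule hexablock_coordinates[OF pentablock_hexablock[OF z]])
    ultimately show "cmod (z $ i) \<le> 2"
      using symmetrized_bidisc_coordinates[of "z $ 2" "z $ 3"] exhaust_3[of i] by auto
  qed
qed

lemma domains_nonempty:
  "ball2 \<noteq> {}" "tetrablock \<noteq> {}" "hexablock \<noteq> {}" "pentablock \<noteq> {}" "symmetrized_bidisc \<noteq> {}" "bidisc \<noteq> {}"
proof -
  have "vector [0, 0] \<in> ball2" by (simp add: ball2_iff)
  then show "ball2 \<noteq> {}" using empty_iff by metis
  have h: "vector [0, 0, 0, 0] \<in> hexablock" by (rule bidisc_hexablock) simp_all
  then show "hexablock \<noteq> {}" using empty_iff by metis
  show "tetrablock \<noteq> {}" using hexablock_tetrablock[OF h] empty_iff by metis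
  show "pentablock \<noteq> {}" using hexablock_pentablock[OF h] empty_iff by metis
  show "symmetrized_bidisc \<noteq> {}"
    using tetrablock_symmetrized[OF hexablock_tetrablock[OF h]] empty_iff by metis
  have "0 \<in> bidisc" by (simp add: bidisc_def)
  then show "bidisc \<noteq> {}" by blast
qed

lemma scaleC_blinfun_simps:
  fixes T :: "'a::complex_hilbert \<Rightarrow>\<^sub>L 'a"
  shows "1 *\<^sub>C T = T" "0 *\<^sub>C T = 0" "c *\<^sub>C (0 :: 'a \<Rightarrow>\<^sub>L 'a) = 0" "(1 / 2) *\<^sub>C T = T /\<^sub>R 2" "(1 / 2) *\<^sub>R T + (1 / 2) *\<^sub>R T = T"
proof -
  show "1 *\<^sub>C T = T" "0 *\<^sub>C T = 0" "c *\<^sub>C (0 :: 'a \<Rightarrow>\<^sub>L 'a) = 0"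
    by (rule blinfun_eqI, simp add: blinfun_apply_scaleC)+
  show "(1 / 2) *\<^sub>C T = T /\<^sub>R 2"
    by (rule blinfun_eqI) (simp add: blinfun_apply_scaleC blinfun.scaleR_left scaleR_scaleC inverse_eq_divide)
  show "(1 / 2) *\<^sub>R T + (1 / 2) *\<^sub>R T = T" by (simp add: scaleR_left_distrib[symmetric])
qed

lemmas linear_image_simps = linear_image_def vec_eq_iff forall_2 forall_3 forall_4 sum_2 sum_3 sum_4
  scaleC_blinfun_simps
lemmas matrix_vector_simps = matrix_vector_mult_def vec_eq_iff forall_2 forall_3 forall_4 sum_2 sum_3 sum_4

section \<open>Subclasses of the hexablock contractions\<close>

lemma ball2_contraction_iff:
  "domain_contraction ball2 (vector [A, X]) \<longleftrightarrow> domain_contraction hexablock (vector [A, X, 0, 0])"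
proof
  let ?L = "vector [vector [1, 0], vector [0, 1], 0, 0] :: complex ^ 2 ^ 4"
  have "?L *v z = vector [z $ 1, z $ 2, 0, 0]" for z by (simp add: matrix_vector_simps)
  then have maps: "?L *v z \<in> hexablock" if "z \<in> ball2" for z
    using that ball2_hexablock[of "z $ 1" "z $ 2"] by (simp add: vector_eta)
  assume "domain_contraction ball2 (vector [A, X])"
  then have "domain_contraction hexablock (linear_image ?L (vector [A, X]))"
    by (rule domain_contraction_linear_image[OF _ domains_nonempty(1) bounded_domains(3) maps])
  moreover have "linear_image ?L (vector [A, X]) = vector [A, X, 0, 0]" by (simp add: linear_image_simps)
  ultimately show "domain_contraction hexablock (vector [A, X, 0, 0])" by simp
next
  let ?L = "vector [vector [1, 0, 0, 0], vector [0, 1, 0, 0]] :: complex ^ 4 ^ 2"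
  have "?L *v z = vector [z $ 1, z $ 2]" for z by (simp add: matrix_vector_simps)
  then have maps: "?L *v z \<in> ball2" if "z \<in> hexablock" for z
    using that hexablock_ball2[of "z $ 1" "z $ 2" "z $ 3" "z $ 4"] by (simp add: vector_eta)
  assume "domain_contraction hexablock (vector [A, X, 0, 0])"
  then have "domain_contraction ball2 (linear_image ?L (vector [A, X, 0, 0]))"
    by (rule domain_contraction_linear_image[OF _ domains_nonempty(3) bounded_domains(1) maps])
  moreover have "linear_image ?L (vector [A, X, 0, 0]) = vector [A, X]" by (simp add: linear_image_simps)
  ultimately show "domain_contraction ball2 (vector [A, X])" by simp
qed

lemma tetrablock_contraction_iff:
  "domain_contraction tetrablock (vector [X1, X2, X3]) \<longleftrightarrow> domain_contraction hexablock (vector [0, X1, X2, X3])"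
proof
  let ?L = "vector [0, vector [1, 0, 0], vector [0, 1, 0], vector [0, 0, 1]] :: complex ^ 3 ^ 4"
  have "?L *v z = vector [0, z $ 1, z $ 2, z $ 3]" for z by (simp add: matrix_vector_simps)
  then have maps: "?L *v z \<in> hexablock" if "z \<in> tetrablock" for z
    using that tetrablock_hexablock[of "z $ 1" "z $ 2" "z $ 3"] by (simp add: vector_eta)
  assume "domain_contraction tetrablock (vector [X1, X2, X3])"
  then have "domain_contraction hexablock (linear_image ?L (vector [X1, X2, X3]))"
    by (rule domain_contraction_linear_image[OF _ domains_nonempty(2) bounded_domains(3) maps])
  moreover have "linear_image ?L (vector [X1, X2, X3]) = vector [0, X1, X2, X3]" by (simp add: linear_image_simps)
  ultimately show "domain_contraction hexablock (vector [0, X1, X2, X3])" by simp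
next
  let ?L = "vector [vector [0, 1, 0, 0], vector [0, 0, 1, 0], vector [0, 0, 0, 1]] :: complex ^ 4 ^ 3"
  have "?L *v z = vector [z $ 2, z $ 3, z $ 4]" for z by (simp add: matrix_vector_simps)
  then have maps: "?L *v z \<in> tetrablock" if "z \<in> hexablock" for z
    using that hexablock_tetrablock[of "z $ 1" "z $ 2" "z $ 3" "z $ 4"] by (simp add: vector_eta)
  assume "domain_contraction hexablock (vector [0, X1, X2, X3])"
  then have "domain_contraction tetrablock (linear_image ?L (vector [0, X1, X2, X3]))"
    by (rule domain_contraction_linear_image[OF _ domains_nonempty(3) bounded_domains(2) maps])
  moreover have "linear_image ?L (vector [0, X1, X2, X3]) = vector [X1, X2, X3]" by (simp add: linear_image_simps)
  ultimately show "domain_contraction tetrablock (vector [X1, X2, X3])" by simp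
qed

lemma pentablock_contraction_iff:
  "domain_contraction pentablock (vector [A, S, P]) \<longleftrightarrow> domain_contraction hexablock (vector [A, S /\<^sub>R 2, S /\<^sub>R 2, P])"
proof
  let ?L = "vector [vector [1, 0, 0], vector [0, 1 / 2, 0], vector [0, 1 / 2, 0], vector [0, 0, 1]] :: complex ^ 3 ^ 4"
  have "?L *v z = vector [z $ 1, z $ 2 / 2, z $ 2 / 2, z $ 3]" for z by (simp add: matrix_vector_simps)
  then have maps: "?L *v z \<in> hexablock" if "z \<in> pentablock" for z
    using that pentablock_hexablock[of "z $ 1" "z $ 2" "z $ 3"] by (simp add: vector_eta)
  assume "domain_contraction pentablock (vector [A, S, P])"
  then have "domain_contraction hexablock (linear_image ?L (vector [A, S, P]))"
    by (rule domain_contraction_linear_image[OF _ domains_nonempty(4) bounded_domains(3) maps])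
  moreover have "linear_image ?L (vector [A, S, P]) = vector [A, S /\<^sub>R 2, S /\<^sub>R 2, P]" by (simp add: linear_image_simps)
  ultimately show "domain_contraction hexablock (vector [A, S /\<^sub>R 2, S /\<^sub>R 2, P])" by simp
next
  let ?L = "vector [vector [1, 0, 0, 0], vector [0, 1, 1, 0], vector [0, 0, 0, 1]] :: complex ^ 4 ^ 3"
  have "?L *v z = vector [z $ 1, z $ 2 + z $ 3, z $ 4]" for z by (simp add: matrix_vector_simps)
  then have maps: "?L *v z \<in> pentablock" if "z \<in> hexablock" for z
    using that hexablock_pentablock[of "z $ 1" "z $ 2" "z $ 3" "z $ 4"] by (simp add: vector_eta)
  assume "domain_contraction hexablock (vector [A, S /\<^sub>R 2, S /\<^sub>R 2, P])"
  then have "domain_contraction pentablock (linear_image ?L (vector [A, S /\<^sub>R 2, S /\<^sub>R 2, P]))"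
    by (rule domain_contraction_linear_image[OF _ domains_nonempty(3) bounded_domains(4) maps])
  moreover have "linear_image ?L (vector [A, S /\<^sub>R 2, S /\<^sub>R 2, P]) = vector [A, S, P]" by (simp add: linear_image_simps)
  ultimately show "domain_contraction pentablock (vector [A, S, P])" by simp
qed

lemma symmetrized_bidisc_contraction_iff:
  "domain_contraction symmetrized_bidisc (vector [S, P]) \<longleftrightarrow> domain_contraction hexablock (vector [0, S /\<^sub>R 2, S /\<^sub>R 2, P])"
proof
  let ?L = "vector [0, vector [1 / 2, 0], vector [1 / 2, 0], vector [0, 1]] :: complex ^ 2 ^ 4"
  have "?L *v z = vector [0, z $ 1 / 2, z $ 1 / 2, z $ 2]" for z by (simp add: matrix_vector_simps)
  then have maps: "?L *v z \<in> hexablock" if "z \<in> symmetrized_bidisc" for z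
    using that tetrablock_hexablock[OF symmetrized_tetrablock[of "z $ 1" "z $ 2"]] by (simp add: vector_eta)
  assume "domain_contraction symmetrized_bidisc (vector [S, P])"
  then have "domain_contraction hexablock (linear_image ?L (vector [S, P]))"
    by (rule domain_contraction_linear_image[OF _ domains_nonempty(5) bounded_domains(3) maps])
  moreover have "linear_image ?L (vector [S, P]) = vector [0, S /\<^sub>R 2, S /\<^sub>R 2, P]" by (simp add: linear_image_simps)
  ultimately show "domain_contraction hexablock (vector [0, S /\<^sub>R 2, S /\<^sub>R 2, P])" by simp
next
  let ?L = "vector [vector [0, 1, 1, 0], vector [0, 0, 0, 1]] :: complex ^ 4 ^ 2"
  have "?L *v z = vector [z $ 2 + z $ 3, z $ 4]" for z by (simp add: matrix_vector_simps)
  then have maps: "?L *v z \<in> symmetrized_bidisc" if "z \<in> hexablock" for z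
    using that tetrablock_symmetrized[OF hexablock_tetrablock[of "z $ 1" "z $ 2" "z $ 3" "z $ 4"]] by (simp add: vector_eta)
  assume "domain_contraction hexablock (vector [0, S /\<^sub>R 2, S /\<^sub>R 2, P])"
  then have "domain_contraction symmetrized_bidisc (linear_image ?L (vector [0, S /\<^sub>R 2, S /\<^sub>R 2, P]))"
    by (rule domain_contraction_linear_image[OF _ domains_nonempty(3) bounded_domains(5) maps])
  moreover have "linear_image ?L (vector [0, S /\<^sub>R 2, S /\<^sub>R 2, P]) = vector [S, P]" by (simp add: linear_image_simps)
  ultimately show "domain_contraction symmetrized_bidisc (vector [S, P])" by simp
qed

text \<open>From left to right this is Ando's inequality; conversely the coordinates are bounded by \<open>1\<close> on the
  hexablock.\<close>

lemma commuting_contractions_iff: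
  assumes lin: "complex_linear A" "complex_linear X"
  shows "A o\<^sub>L X = X o\<^sub>L A \<and> norm A \<le> 1 \<and> norm X \<le> 1 \<longleftrightarrow> domain_contraction hexablock (vector [A, 0, 0, X])"
proof
  let ?L = "vector [vector [1, 0], 0, 0, vector [0, 1]] :: complex ^ 2 ^ 4"
  have "?L *v z = vector [z $ 1, 0, 0, z $ 2]" for z by (simp add: matrix_vector_simps)
  then have maps: "?L *v z \<in> hexablock" if "z \<in> bidisc" for z
    using that by (simp add: bidisc_def bidisc_hexablock)
  assume "A o\<^sub>L X = X o\<^sub>L A \<and> norm A \<le> 1 \<and> norm X \<le> 1"
  then have "domain_contraction bidisc (vector [A, X])" using ando_bidisc lin by blast
  then have "domain_contraction hexablock (linear_image ?L (vector [A, X]))"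
    by (rule domain_contraction_linear_image[OF _ domains_nonempty(6) bounded_domains(3) maps])
  moreover have "linear_image ?L (vector [A, X]) = vector [A, 0, 0, X]" by (simp add: linear_image_simps)
  ultimately show "domain_contraction hexablock (vector [A, 0, 0, X])" by simp
next
  let ?L = "vector [vector [1, 0, 0, 0], vector [0, 0, 0, 1]] :: complex ^ 4 ^ 2"
  have "?L *v z = vector [z $ 1, z $ 4]" for z by (simp add: matrix_vector_simps)
  then have maps: "?L *v z \<in> bidisc" if "z \<in> hexablock" for z
    using that hexablock_coordinates[of "z $ 1" "z $ 2" "z $ 3" "z $ 4"] by (simp add: vector_eta bidisc_def)
  assume "domain_contraction hexablock (vector [A, 0, 0, X])"
  then have "domain_contraction bidisc (linear_image ?L (vector [A, 0, 0, X]))"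
    by (rule domain_contraction_linear_image[OF _ domains_nonempty(3) bounded_bidisc maps])
  moreover have "linear_image ?L (vector [A, 0, 0, X]) = vector [A, X]" by (simp add: linear_image_simps)
  ultimately have AX: "domain_contraction bidisc (vector [A, X])" by simp
  then have "commuting_tuple (vector [A, X] :: _ ^ 2)" unfolding domain_contraction_def by (elim conjE)
  then have "A o\<^sub>L X = X o\<^sub>L A"
    unfolding commuting_tuple_def by (elim allE[of _ 1] allE[of _ 2]) simp
  then show "A o\<^sub>L X = X o\<^sub>L A \<and> norm A \<le> 1 \<and> norm X \<le> 1"
    using bidisc_contraction_norm[OF AX, of 1] bidisc_contraction_norm[OF AX, of 2] by simp
qed

theorem theorem2p13:
  fixes A X1 X2 X3 S P :: "'a::complex_hilbert \<Rightarrow>\<^sub>L 'a"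
  assumes "complex_linear A" "complex_linear X1" "complex_linear X2" "complex_linear X3"
    and "complex_linear S" "complex_linear P"
  shows "(domain_contraction ball2 (vector [A, X1])
        \<longleftrightarrow> domain_contraction hexablock (vector [A, X1, 0, 0])) \<and>
      (domain_contraction tetrablock (vector [X1, X2, X3])
        \<longleftrightarrow> domain_contraction hexablock (vector [0, X1, X2, X3])) \<and>
      (domain_contraction pentablock (vector [A, S, P])
        \<longleftrightarrow> domain_contraction hexablock (vector [A, S /\<^sub>R 2, S /\<^sub>R 2, P])) \<and>
      (domain_contraction symmetrized_bidisc (vector [S, P])
        \<longleftrightarrow> domain_contraction hexablock (vector [0, S /\<^sub>R 2, S /\<^sub>R 2, P])) \<and>
      (A o\<^sub>L X3 = X3 o\<^sub>L A \<and> norm A \<le> 1 \<and> norm X3 \<le> 1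
        \<longleftrightarrow> domain_contraction hexablock (vector [A, 0, 0, X3]))"
  using assms by (intro conjI ball2_contraction_iff tetrablock_contraction_iff pentablock_contraction_iff
      symmetrized_bidisc_contraction_iff commuting_contractions_iff)

end
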